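(* Let $\frac d2<p<2$, $p':=\frac{2p}{2-p}$, $\bar u\in L^2(\Omega)$ and $\mu>0$, and assume that $$L_p|\Omega|^{1/2}\bigl(2|\{F(\bar u)=0\}|\bigr)^{1/p'}<\mu .$$ Then there exists $\rho>0$ such that $$\|F(\hat u)-F(u)-G_u(\hat u-u)\|_{L^2(\Omega)}\le\mu\|F(\hat u)-F(u)\|_{L^2(\Omega)}$$ for all $u,\hat u\in\overline B_{L^2(\Omega)}(\bar u,\rho)$.
   Context: $\Omega\subset\mathbb R^d$, $d\in\{2,3\}$, is a bounded domain with Lipschitz boundary; $|S|$ is Lebesgue measure; $\overline B_{L^2(\Omega)}(\bar u,\rho)$ is the closed ball. $F:L^2(\Omega)\to H^1_0(\Omega)\cap C(\overline\Omega)$ is the solution operator $u\mapsto y_u$ of $-\Delta y+y^+=u$ in $\Omega$, $y=0$ on $\partial\Omega$ (weak sense; uniquely solvable), where $y^+=\max(y,0)$ pointwise. For $u\in L^2(\Omega)$, $G_u$ is the solution operator $h\mapsto\eta\in H^1_0(\Omega)$ of the linear equation $-\Delta\eta+\mathbf 1_{\{y_u>0\}}\eta=h$ in $\Omega$, $\eta=0$ on $\partial\Omega$, with $y_u=F(u)$; it is considered for $h\in L^2(\Omega)$ and also for $h\in L^p(\Omega)$, $\frac d2<p\le2$. $L_p>0$ is a constant such that $\|G_uh\|_{C(\overline\Omega)}\le L_p\|h\|_{L^p(\Omega)}$ for all $h\in L^p(\Omega)$ and all $u\in L^2(\Omega)$ (such a constant exists). $\{F(\bar u)=0\}$ is the set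 of $x\in\Omega$ with $F(\bar u)(x)=0$. *)

theory Defs
  imports "HOL-Analysis.Analysis"
begin

section \<open>Bounded Lipschitz domains\<close>

text \<open>Near each boundary point, \<open>\<Omega>\<close> is the strict epigraph, in some direction \<open>e\<close>, of a Lipschitz
  function on the hyperplane orthogonal to \<open>e\<close>.\<close>

definition lipschitz_boundary :: "'a::euclidean_space set \<Rightarrow> bool" where
  "lipschitz_boundary \<Omega> \<longleftrightarrow>
     (\<forall>a\<in>frontier \<Omega>. \<exists>e r L \<gamma>. norm e = 1 \<and> r > 0 \<and>
        L-lipschitz_on {z. z \<bullet> e = 0} (\<gamma> :: 'a \<Rightarrow> real) \<and>
        \<Omega> \<inter> ball a r = {x \<in> ball a r. x \<bullet> e > \<gamma> (x - (x \<bullet> e) *\<^sub>R e)})"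

definition bounded_lipschitz_domain :: "'a::euclidean_space set \<Rightarrow> bool" where
  "bounded_lipschitz_domain \<Omega> \<longleftrightarrow>
     open \<Omega> \<and> connected \<Omega> \<and> \<Omega> \<noteq> {} \<and> bounded \<Omega> \<and> lipschitz_boundary \<Omega>"

section \<open>Function spaces\<close>

text \<open>Elements of \<open>L\<^sup>p(\<Omega>)\<close> are represented by functions on the whole space; values outside \<open>\<Omega>\<close>
  are irrelevant, and no quotient by almost-everywhere equality is taken.\<close>

definition Lp :: "real \<Rightarrow> 'a::euclidean_space set \<Rightarrow> ('a \<Rightarrow> 'b::euclidean_space) set" where
  "Lp p \<Omega> = {f \<in> borel_measurable (lebesgue_on \<Omega>).
               integrable (lebesgue_on \<Omega>) (\<lambda>x. norm (f x) powr p)}"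

definition Lp_norm :: "real \<Rightarrow> 'a::euclidean_space set \<Rightarrow> ('a \<Rightarrow> 'b::euclidean_space) \<Rightarrow> real" where
  "Lp_norm p \<Omega> f = (\<integral>x. norm (f x) powr p \<partial>lebesgue_on \<Omega>) powr (1 / p)"

definition L2_cball ::
  "'a::euclidean_space set \<Rightarrow> ('a \<Rightarrow> real) \<Rightarrow> real \<Rightarrow> ('a \<Rightarrow> real) set" where
  "L2_cball \<Omega> c \<rho> = {u \<in> Lp 2 \<Omega>. Lp_norm 2 \<Omega> (\<lambda>x. u x - c x) \<le> \<rho>}"

definition sup_norm :: "'a::euclidean_space set \<Rightarrow> ('a \<Rightarrow> real) \<Rightarrow> real" where
  "sup_norm \<Omega> y = (SUP x\<in>closure \<Omega>. \<bar>y x\<bar>)"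

primrec C_k :: "nat \<Rightarrow> ('a::euclidean_space \<Rightarrow> real) \<Rightarrow> bool" where
  "C_k 0 f \<longleftrightarrow> continuous_on UNIV f"
| "C_k (Suc k) f \<longleftrightarrow> (\<forall>x. f differentiable at x) \<and>
     (\<forall>i\<in>Basis. C_k k (\<lambda>x. frechet_derivative f (at x) i))"

definition test_functions :: "'a::euclidean_space set \<Rightarrow> ('a \<Rightarrow> real) set" where
  "test_functions \<Omega> = {\<phi>. (\<forall>k. C_k k \<phi>) \<and>
     compact (closure {x. \<phi> x \<noteq> 0}) \<and> closure {x. \<phi> x \<noteq> 0} \<subseteq> \<Omega>}"

definition gradient :: "('a::euclidean_space \<Rightarrow> real) \<Rightarrow> 'a \<Rightarrow> 'a" where
  "gradient \<phi> x = (\<Sum>i\<in>Basis. frechet_derivative \<phi> (at x) i *\<^sub>R i)"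

text \<open>\<open>y \<in> H\<^sup>1(\<Omega>)\<close> with weak gradient \<open>g\<close>.\<close>

definition has_weak_gradient ::
  "'a::euclidean_space set \<Rightarrow> ('a \<Rightarrow> real) \<Rightarrow> ('a \<Rightarrow> 'a) \<Rightarrow> bool" where
  "has_weak_gradient \<Omega> y g \<longleftrightarrow> y \<in> Lp 2 \<Omega> \<and> g \<in> Lp 2 \<Omega> \<and>
     (\<forall>\<phi>\<in>test_functions \<Omega>. \<forall>i\<in>Basis.
        (\<integral>x. y x * frechet_derivative \<phi> (at x) i \<partial>lebesgue_on \<Omega>)
          = - (\<integral>x. (g x \<bullet> i) * \<phi> x \<partial>lebesgue_on \<Omega>))"

text \<open>\<open>y \<in> H\<^sup>1\<^sub>0(\<Omega>)\<close>, the closure of the test functions in the \<open>H\<^sup>1\<close> norm, with weak gradient \<open>g\<close>.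
  The gradient is kept as an argument because it is only determined almost everywhere.\<close>

definition has_H10_gradient ::
  "'a::euclidean_space set \<Rightarrow> ('a \<Rightarrow> real) \<Rightarrow> ('a \<Rightarrow> 'a) \<Rightarrow> bool" where
  "has_H10_gradient \<Omega> y g \<longleftrightarrow> has_weak_gradient \<Omega> y g \<and>
     (\<exists>\<phi>. (\<forall>n. \<phi> n \<in> test_functions \<Omega>) \<and>
        (\<lambda>n. Lp_norm 2 \<Omega> (\<lambda>x. \<phi> n x - y x)) \<longlonglongrightarrow> 0 \<and>
        (\<lambda>n. Lp_norm 2 \<Omega> (\<lambda>x. gradient (\<phi> n) x - g x)) \<longlonglongrightarrow> 0)"

section \<open>The state equation and its linearization\<close>

text \<open>\<open>y \<in> H\<^sup>1\<^sub>0(\<Omega>)\<close> is a weak solution of \<open>-\<Delta>y + r = f\<close> in \<open>\<Omega>\<close>, \<open>y = 0\<close> on \<open>\<partial>\<Omega>\<close>; in the uses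
  below the reaction term \<open>r\<close> depends on \<open>y\<close>.\<close>

definition weak_dirichlet_solution ::
  "'a::euclidean_space set \<Rightarrow> ('a \<Rightarrow> real) \<Rightarrow> ('a \<Rightarrow> real) \<Rightarrow> ('a \<Rightarrow> real) \<Rightarrow> bool" where
  "weak_dirichlet_solution \<Omega> y r f \<longleftrightarrow>
     (\<exists>g. has_H10_gradient \<Omega> y g \<and>
       (\<forall>v w. has_H10_gradient \<Omega> v w \<longrightarrow>
          (\<integral>x. g x \<bullet> w x \<partial>lebesgue_on \<Omega>) + (\<integral>x. r x * v x \<partial>lebesgue_on \<Omega>)
            = (\<integral>x. f x * v x \<partial>lebesgue_on \<Omega>)))"

text \<open>\<open>F : L\<^sup>2(\<Omega>) \<rightarrow> H\<^sup>1\<^sub>0(\<Omega>) \<inter> C(closure \<Omega>)\<close>, with \<open>F u\<close> solving \<open>-\<Delta>y + max y 0 = u\<close>. Continuity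
  selects the representative, so \<open>F u\<close> is pointwise meaningful on \<open>closure \<Omega>\<close>.\<close>

definition is_solution_operator ::
  "'a::euclidean_space set \<Rightarrow> (('a \<Rightarrow> real) \<Rightarrow> ('a \<Rightarrow> real)) \<Rightarrow> bool" where
  "is_solution_operator \<Omega> F \<longleftrightarrow>
     (\<forall>u\<in>Lp 2 \<Omega>. continuous_on (closure \<Omega>) (F u) \<and>
        weak_dirichlet_solution \<Omega> (F u) (\<lambda>x. max (F u x) 0) u)"

text \<open>\<open>G u h\<close> solves \<open>-\<Delta>\<eta> + 1[F u > 0] \<eta> = h\<close>, for \<open>h \<in> L\<^sup>q(\<Omega>)\<close> with \<open>d/2 < q \<le> 2\<close>.\<close>

definition is_linearized_operator ::
  "'a::euclidean_space set \<Rightarrow> (('a \<Rightarrow> real) \<Rightarrow> ('a \<Rightarrow> real)) \<Rightarrow>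
     (('a \<Rightarrow> real) \<Rightarrow> ('a \<Rightarrow> real) \<Rightarrow> ('a \<Rightarrow> real)) \<Rightarrow> bool" where
  "is_linearized_operator \<Omega> F G \<longleftrightarrow>
     (\<forall>u\<in>Lp 2 \<Omega>. \<forall>q. real DIM('a) / 2 < q \<and> q \<le> 2 \<longrightarrow>
        (\<forall>h\<in>Lp q \<Omega>. weak_dirichlet_solution \<Omega> (G u h)
           (\<lambda>x. indicator {z. F u z > 0} x * G u h x) h))"

end

theory Submission
  imports Defs
begin

text \<open>
  The positive part is linear away from zero, so the linearization of \<open>F\<close> at \<open>u\<close> is exact except where
  \<open>F u\<close> and \<open>F uhat\<close> have different signs. Precisely, the linearization error \<open>w\<close> equals \<open>G u h\<close> for a
  right-hand side \<open>h\<close> that is dominated by \<open>\<bar>F uhat - F u\<bar>\<close> and supported in the set \<open>S\<close> where exactly one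
  of \<open>F u\<close> and \<open>F uhat\<close> is positive. The sup-norm bound for \<open>G u\<close> and Hoelder's inequality on \<open>S\<close> give
  \<open>\<parallel>w\<parallel> \<le> L |\<Omega>|\<^bsup>1/2\<^esup> |S|\<^bsup>1/p'\<^esup> \<parallel>F uhat - F u\<parallel>\<close> in the norm of \<open>L\<^sup>2\<close>, because
  \<open>1/p' = 1/p - 1/2\<close> (\<open>linearization_error_le\<close>).

  It remains to bound \<open>|S|\<close>, which asymptotically cannot exceed the measure of the zero set of \<open>F ubar\<close>
  (\<open>measure_sign_change_set_le\<close>): this only takes convergence of \<open>F u\<close> to \<open>F ubar\<close> in measure, which
  follows from the Lipschitz continuity of \<open>F\<close> from \<open>L\<^sup>2\<close> to \<open>L\<^sup>2\<close>
  (\<open>semilinear_solution_Lipschitz\<close>). The Lipschitz bound and the uniqueness used to identify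
  \<open>w\<close> with \<open>G u h\<close> both come from one energy estimate (\<open>energy_estimate\<close>), which rests on the Poincare
  inequality on bounded open sets (\<open>Poincare_inequality\<close>).
\<close>

section \<open>Square-integrable functions\<close>

lemma Lp_2_iff:
  "f \<in> Lp 2 \<Omega> \<longleftrightarrow> f \<in> borel_measurable (lebesgue_on \<Omega>) \<and>
     integrable (lebesgue_on \<Omega>) (\<lambda>x. (norm (f x))\<^sup>2)"
  by (simp add: Lp_def)

lemma Lp_norm_2: "Lp_norm 2 \<Omega> f = sqrt (\<integral>x. (norm (f x))\<^sup>2 \<partial>lebesgue_on \<Omega>)"
  by (simp add: Lp_norm_def powr_half_sqrt)

lemma Lp_norm_2_nonneg: "0 \<le> Lp_norm 2 \<Omega> f"
  by (simp add: Lp_norm_2)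

lemma Lp_norm_2_square: "(Lp_norm 2 \<Omega> f)\<^sup>2 = (\<integral>x. (norm (f x))\<^sup>2 \<partial>lebesgue_on \<Omega>)"
  by (simp add: Lp_norm_2)

lemma Lp_2_dominated:
  assumes g: "g \<in> Lp 2 \<Omega>" and f: "f \<in> borel_measurable (lebesgue_on \<Omega>)"
    and le: "\<And>x. x \<in> \<Omega> \<Longrightarrow> norm (f x) \<le> C * norm (g x)"
  shows "f \<in> Lp 2 \<Omega>"
proof -
  have "integrable (lebesgue_on \<Omega>) (\<lambda>x. (norm (f x))\<^sup>2)"
  proof (rule Bochner_Integration.integrable_bound)
    show "integrable (lebesgue_on \<Omega>) (\<lambda>x. C\<^sup>2 * (norm (g x))\<^sup>2)"
      using g by (simp add: Lp_2_iff)
    show "(\<lambda>x. (norm (f x))\<^sup>2) \<in> borel_measurable (lebesgue_on \<Omega>)"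
      using f by simp
    show "AE x in lebesgue_on \<Omega>. norm ((norm (f x))\<^sup>2) \<le> norm (C\<^sup>2 * (norm (g x))\<^sup>2)"
    proof (rule AE_I2)
      fix x assume "x \<in> space (lebesgue_on \<Omega>)"
      then have "norm (f x) \<le> C * norm (g x)"
        using le by simp
      then have "(norm (f x))\<^sup>2 \<le> (C * norm (g x))\<^sup>2"
        by (intro power_mono) auto
      then show "norm ((norm (f x))\<^sup>2) \<le> norm (C\<^sup>2 * (norm (g x))\<^sup>2)"
        by (simp add: power_mult_distrib)
    qed
  qed
  with f show ?thesis
    by (simp add: Lp_2_iff)
qed

lemma Lp_norm_2_dominated:
  assumes g: "g \<in> Lp 2 \<Omega>" and f: "f \<in> Lp 2 \<Omega>"
    and le: "\<And>x. x \<in> \<Omega> \<Longrightarrow> norm (f x) \<le> C * norm (g x)" and C: "0 \<le> C"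
  shows "Lp_norm 2 \<Omega> f \<le> C * Lp_norm 2 \<Omega> g"
proof (rule power2_le_imp_le)
  have "(norm (f x))\<^sup>2 \<le> C\<^sup>2 * (norm (g x))\<^sup>2" if "x \<in> \<Omega>" for x
    using power_mono[OF le[OF that], of 2] by (simp add: power_mult_distrib)
  then have "(\<integral>x. (norm (f x))\<^sup>2 \<partial>lebesgue_on \<Omega>) \<le> (\<integral>x. C\<^sup>2 * (norm (g x))\<^sup>2 \<partial>lebesgue_on \<Omega>)"
    using f g by (intro integral_mono) (auto simp: Lp_2_iff)
  then show "(Lp_norm 2 \<Omega> f)\<^sup>2 \<le> (C * Lp_norm 2 \<Omega> g)\<^sup>2"
    by (simp add: Lp_norm_2_square power_mult_distrib)
qed (simp add: Lp_norm_2_nonneg C)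

lemma zero_Lp_2: "(\<lambda>x. 0) \<in> Lp 2 \<Omega>"
  by (simp add: Lp_2_iff)

lemma max_zero_Lp_2:
  fixes f :: "'a::euclidean_space \<Rightarrow> real"
  assumes "f \<in> Lp 2 \<Omega>"
  shows "(\<lambda>x. max (f x) 0) \<in> Lp 2 \<Omega>"
proof (rule Lp_2_dominated[OF assms])
  show "(\<lambda>x. max (f x) 0) \<in> borel_measurable (lebesgue_on \<Omega>)"
    using assms by (intro borel_measurable_max) (simp_all add: Lp_2_iff)
  show "norm (max (f x) 0) \<le> 1 * norm (f x)" for x
    by simp
qed

lemma integrable_inner_Lp_2:
  assumes "f \<in> Lp 2 \<Omega>" "g \<in> Lp 2 \<Omega>"
  shows "integrable (lebesgue_on \<Omega>) (\<lambda>x. f x \<bullet> g x)"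
proof (rule Bochner_Integration.integrable_bound)
  show "integrable (lebesgue_on \<Omega>) (\<lambda>x. (norm (f x))\<^sup>2 + (norm (g x))\<^sup>2)"
    using assms by (simp add: Lp_2_iff)
  show "(\<lambda>x. f x \<bullet> g x) \<in> borel_measurable (lebesgue_on \<Omega>)"
    using assms by (intro borel_measurable_inner) (simp_all add: Lp_2_iff)
  have "\<bar>f x \<bullet> g x\<bar> \<le> (norm (f x))\<^sup>2 + (norm (g x))\<^sup>2" for x
  proof -
    have "\<bar>f x \<bullet> g x\<bar> \<le> norm (f x) * norm (g x)"
      by (rule Cauchy_Schwarz_ineq2)
    also have "\<dots> \<le> (norm (f x))\<^sup>2 + (norm (g x))\<^sup>2"
    proof -
      have "0 \<le> norm (f x) * norm (g x)"
        by simp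
      then show ?thesis
        using sum_squares_bound[of "norm (f x)" "norm (g x)"] by linarith
    qed
    finally show ?thesis .
  qed
  then show "AE x in lebesgue_on \<Omega>. norm (f x \<bullet> g x) \<le> norm ((norm (f x))\<^sup>2 + (norm (g x))\<^sup>2)"
    by simp
qed

lemma integrable_mult_Lp_2:
  fixes f g :: "'a::euclidean_space \<Rightarrow> real"
  assumes "f \<in> Lp 2 \<Omega>" "g \<in> Lp 2 \<Omega>"
  shows "integrable (lebesgue_on \<Omega>) (\<lambda>x. f x * g x)"
  using integrable_inner_Lp_2[OF assms] by simp

lemma Lp_2_diff:
  assumes f: "f \<in> Lp 2 \<Omega>" and g: "g \<in> Lp 2 \<Omega>"
  shows "(\<lambda>x. f x - g x) \<in> Lp 2 \<Omega>"
proof -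
  have "(norm (f x - g x))\<^sup>2 = (norm (f x))\<^sup>2 - 2 * (f x \<bullet> g x) + (norm (g x))\<^sup>2" for x
    by (simp add: power2_norm_eq_inner inner_diff inner_commute)
  moreover have "integrable (lebesgue_on \<Omega>)
      (\<lambda>x. (norm (f x))\<^sup>2 - 2 * (f x \<bullet> g x) + (norm (g x))\<^sup>2)"
    using f g integrable_inner_Lp_2[OF f g] by (simp add: Lp_2_iff)
  ultimately show ?thesis
    using f g borel_measurable_diff[of f "lebesgue_on \<Omega>" g] by (simp add: Lp_2_iff)
qed

lemma Lp_norm_2_scaleR_diff_square:
  assumes f: "f \<in> Lp 2 \<Omega>" and g: "g \<in> Lp 2 \<Omega>"
  shows "(Lp_norm 2 \<Omega> (\<lambda>x. c *\<^sub>R f x - g x))\<^sup>2 =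
    c\<^sup>2 * (Lp_norm 2 \<Omega> f)\<^sup>2 - 2 * c * (\<integral>x. f x \<bullet> g x \<partial>lebesgue_on \<Omega>) + (Lp_norm 2 \<Omega> g)\<^sup>2"
proof -
  have "(norm (c *\<^sub>R f x - g x))\<^sup>2 =
      c\<^sup>2 * (norm (f x))\<^sup>2 - 2 * c * (f x \<bullet> g x) + (norm (g x))\<^sup>2" for x
    unfolding power2_norm_eq_inner inner_diff_left inner_diff_right inner_scaleR_left inner_scaleR_right
      inner_commute[of "g x" "f x"] by (simp add: algebra_simps power2_eq_square)
  then show ?thesis
    using f g integrable_inner_Lp_2[OF f g] by (simp add: Lp_norm_2_square Lp_2_iff)
qed

text \<open>The quadratic polynomial \<open>t \<mapsto> \<parallel>t f - g\<parallel>\<^sup>2\<close> is nonnegative, so its discriminant is not positive.\<close>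

lemma Cauchy_Schwarz_Lp_2:
  assumes f: "f \<in> Lp 2 \<Omega>" and g: "g \<in> Lp 2 \<Omega>"
  shows "\<bar>\<integral>x. f x \<bullet> g x \<partial>lebesgue_on \<Omega>\<bar> \<le> Lp_norm 2 \<Omega> f * Lp_norm 2 \<Omega> g"
proof -
  define a b c where "a = Lp_norm 2 \<Omega> f" and "b = Lp_norm 2 \<Omega> g"
    and "c = (\<integral>x. f x \<bullet> g x \<partial>lebesgue_on \<Omega>)"
  have a: "a \<ge> 0" and b: "b \<ge> 0"
    by (simp_all add: a_def b_def Lp_norm_2_nonneg)
  have q: "0 \<le> t\<^sup>2 * a\<^sup>2 - 2 * t * c + b\<^sup>2" for t
    unfolding a_def b_def c_def Lp_norm_2_scaleR_diff_square[OF f g, symmetric] by simp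
  have "c\<^sup>2 \<le> (a * b)\<^sup>2"
  proof (cases "a = 0")
    case True
    show ?thesis
    proof (cases "c = 0")
      case False
      then show ?thesis
        \<comment> \<open>the polynomial is affine in \<open>t\<close> with slope \<open>- 2 c\<close>; at this \<open>t\<close> its value would be \<open>- 1\<close>\<close>
        using q[of "(b\<^sup>2 + 1) / (2 * c)"] True by simp
    qed simp
  next
    case False
    then show ?thesis
      \<comment> \<open>the minimiser of the polynomial\<close>
      using q[of "c / a\<^sup>2"] a
      by (simp add: field_simps power2_eq_square split: if_splits)
  qed
  then show ?thesis
    unfolding a_def[symmetric] b_def[symmetric] c_def[symmetric]
    using a b by (metis abs_le_square_iff abs_of_nonneg mult_nonneg_nonneg)
qed

lemma Lp_norm_2_triangle_diff:
  assumes f: "f \<in> Lp 2 \<Omega>" and g: "g \<in> Lp 2 \<Omega>"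
  shows "Lp_norm 2 \<Omega> (\<lambda>x. f x - g x) \<le> Lp_norm 2 \<Omega> f + Lp_norm 2 \<Omega> g"
proof (rule power2_le_imp_le)
  show "(Lp_norm 2 \<Omega> (\<lambda>x. f x - g x))\<^sup>2 \<le> (Lp_norm 2 \<Omega> f + Lp_norm 2 \<Omega> g)\<^sup>2"
    using Lp_norm_2_scaleR_diff_square[OF f g, of 1] Cauchy_Schwarz_Lp_2[OF f g]
    by (simp add: power2_sum)
qed (simp add: Lp_norm_2_nonneg)

lemma tendsto_integral_inner_Lp_2:
  assumes f: "\<And>n. f n \<in> Lp 2 \<Omega>" and k: "k \<in> Lp 2 \<Omega>" and g: "g \<in> Lp 2 \<Omega>"
    and lim: "(\<lambda>n. Lp_norm 2 \<Omega> (\<lambda>x. f n x - k x)) \<longlonglongrightarrow> 0"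
  shows "(\<lambda>n. \<integral>x. f n x \<bullet> g x \<partial>lebesgue_on \<Omega>) \<longlonglongrightarrow> (\<integral>x. k x \<bullet> g x \<partial>lebesgue_on \<Omega>)"
proof (rule LIM_zero_cancel, rule Lim_null_comparison)
  show "(\<lambda>n. Lp_norm 2 \<Omega> (\<lambda>x. f n x - k x) * Lp_norm 2 \<Omega> g) \<longlonglongrightarrow> 0"
    using tendsto_mult_right[OF lim] by simp
  have "(\<integral>x. f n x \<bullet> g x \<partial>lebesgue_on \<Omega>) - (\<integral>x. k x \<bullet> g x \<partial>lebesgue_on \<Omega>) =
      (\<integral>x. (f n x - k x) \<bullet> g x \<partial>lebesgue_on \<Omega>)" for n
    using integrable_inner_Lp_2[OF f g] integrable_inner_Lp_2[OF k g]
    by (simp add: inner_diff_left)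
  then show "\<forall>\<^sub>F n in sequentially. norm ((\<integral>x. f n x \<bullet> g x \<partial>lebesgue_on \<Omega>) -
      (\<integral>x. k x \<bullet> g x \<partial>lebesgue_on \<Omega>)) \<le> Lp_norm 2 \<Omega> (\<lambda>x. f n x - k x) * Lp_norm 2 \<Omega> g"
    using Cauchy_Schwarz_Lp_2[OF Lp_2_diff[OF f k] g] by simp
qed

lemma Lp_norm_2_diff_tendsto_zero:
  assumes L2: "\<And>n. f n \<in> Lp 2 \<Omega>" "\<And>n. h n \<in> Lp 2 \<Omega>"
    and lim: "(\<lambda>n. Lp_norm 2 \<Omega> (f n)) \<longlonglongrightarrow> 0" "(\<lambda>n. Lp_norm 2 \<Omega> (h n)) \<longlonglongrightarrow> 0"
  shows "(\<lambda>n. Lp_norm 2 \<Omega> (\<lambda>x. f n x - h n x)) \<longlonglongrightarrow> 0"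
proof (rule Lim_null_comparison)
  show "(\<lambda>n. Lp_norm 2 \<Omega> (f n) + Lp_norm 2 \<Omega> (h n)) \<longlonglongrightarrow> 0"
    using tendsto_add[OF lim] by simp
qed (simp add: Lp_norm_2_triangle_diff L2 Lp_norm_2_nonneg)

lemma Lp_2_bounded:
  assumes \<Omega>: "\<Omega> \<in> lmeasurable" and f: "f \<in> borel_measurable (lebesgue_on \<Omega>)"
    and le: "\<And>x. x \<in> \<Omega> \<Longrightarrow> norm (f x) \<le> C"
  shows "f \<in> Lp 2 \<Omega>"
proof (rule Lp_2_dominated[where g = "\<lambda>x. 1::real" and C = C])
  show "(\<lambda>x. 1::real) \<in> Lp 2 \<Omega>"
    using finite_measure_lebesgue_on[OF \<Omega>] by (simp add: Lp_2_iff finite_measure.integrable_const)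
qed (use f le in auto)

lemma continuous_Lp_2:
  fixes f :: "'a::euclidean_space \<Rightarrow> 'b::euclidean_space"
  assumes \<Omega>: "open \<Omega>" "bounded \<Omega>" and f: "continuous_on UNIV f"
  shows "f \<in> Lp 2 \<Omega>"
proof -
  have lm: "\<Omega> \<in> lmeasurable"
    using \<Omega> by (intro lmeasurable_open)
  have "compact (f ` closure \<Omega>)"
    using \<Omega>(2) by (intro compact_continuous_image continuous_on_subset[OF f]) (auto simp: compact_closure)
  then obtain C where "\<forall>y\<in>f ` closure \<Omega>. norm y \<le> C"
    using compact_imp_bounded bounded_iff by metis
  then have "norm (f x) \<le> C" if "x \<in> \<Omega>" for x
    using that closure_subset by blast
  moreover have "f \<in> borel_measurable (lebesgue_on \<Omega>)"
    using f lm by (intro continuous_imp_measurable_on_sets_lebesgue) (auto intro: continuous_on_subset)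
  ultimately show ?thesis
    using lm by (intro Lp_2_bounded) auto
qed

section \<open>Test functions\<close>

lemma C_k_linear_combination:
  assumes "C_k k \<phi>" "C_k k \<psi>"
  shows "C_k k (\<lambda>x. a * \<phi> x + b * \<psi> x)"
  using assms
proof (induction k arbitrary: \<phi> \<psi>)
  case (Suc k)
  have d: "frechet_derivative (\<lambda>x. a * \<phi> x + b * \<psi> x) (at x) =
      (\<lambda>i. a * frechet_derivative \<phi> (at x) i + b * frechet_derivative \<psi> (at x) i)" for x
    using Suc.prems
    by (intro frechet_derivative_at[symmetric] has_derivative_add has_derivative_mult_right)
       (auto simp: frechet_derivative_works[symmetric])
  show ?case
    using Suc by (auto simp: d intro!: derivative_intros)
qed (auto intro!: continuous_intros)

lemma C_k_Suc_imp: "C_k (Suc k) \<phi> \<Longrightarrow> C_k k \<phi>"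
proof (induction k arbitrary: \<phi>)
  case 0
  then show ?case
    by (auto intro!: continuous_at_imp_continuous_on differentiable_imp_continuous_within)
qed auto

lemma frechet_derivative_coordinate_mult:
  fixes \<phi> :: "'a::euclidean_space \<Rightarrow> real"
  assumes "\<phi> differentiable at x"
  shows "frechet_derivative (\<lambda>x. (x \<bullet> a) * \<phi> x) (at x) =
    (\<lambda>i. (i \<bullet> a) * \<phi> x + (x \<bullet> a) * frechet_derivative \<phi> (at x) i)"
proof -
  have "((\<lambda>x. (x \<bullet> a) * \<phi> x) has_derivative
      (\<lambda>i. (x \<bullet> a) * frechet_derivative \<phi> (at x) i + (i \<bullet> a) * \<phi> x)) (at x)"
    using assms by (auto intro!: derivative_intros simp: frechet_derivative_works[symmetric])
  then show ?thesis
    by (simp add: frechet_derivative_at[symmetric] add.commute)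
qed

text \<open>The derivatives of \<open>(x \<bullet> a) \<phi>\<close> are linear combinations of \<open>\<phi>\<close> and of \<open>x \<bullet> a\<close> times a derivative of \<open>\<phi>\<close>, so
  the induction on the order stays within functions of this form.\<close>

lemma C_k_coordinate_mult: "C_k k \<phi> \<Longrightarrow> C_k k (\<lambda>x. (x \<bullet> a) * \<phi> x)"
proof (induction k arbitrary: \<phi>)
  case (Suc k)
  have "C_k k (\<lambda>x. (i \<bullet> a) * \<phi> x + 1 * ((x \<bullet> a) * frechet_derivative \<phi> (at x) i))"
    if "i \<in> Basis" for i
    using that Suc C_k_Suc_imp by (intro C_k_linear_combination) auto
  with Suc.prems show ?case
    by (auto simp: frechet_derivative_coordinate_mult intro!: derivative_intros)
qed (auto intro!: continuous_intros)

lemma test_functionsI: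
  assumes "\<And>k. C_k k \<psi>" "compact K" "K \<subseteq> \<Omega>" "\<And>x. x \<notin> K \<Longrightarrow> \<psi> x = 0"
  shows "\<psi> \<in> test_functions \<Omega>"
proof -
  have "closure {x. \<psi> x \<noteq> 0} \<subseteq> K"
    using assms by (intro closure_minimal compact_imp_closed) auto
  moreover have "compact (closure {x. \<psi> x \<noteq> 0})"
    using \<open>compact K\<close> calculation by (metis closed_closure compact_Int_closed inf.absorb_iff2)
  ultimately show ?thesis
    using assms by (auto simp: test_functions_def simp del: compact_closure)
qed

text \<open>Provides the test functions for the proof of the Poincare inequality.\<close>

lemma test_functions_coordinate_mult:
  assumes "\<phi> \<in> test_functions \<Omega>"
  shows "(\<lambda>x. (x \<bullet> a) * \<phi> x) \<in> test_functions \<Omega>"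
proof (rule test_functionsI[where K = "closure {x. \<phi> x \<noteq> 0}"])
  show "(x \<bullet> a) * \<phi> x = 0" if "x \<notin> closure {x. \<phi> x \<noteq> 0}" for x
    using that closure_subset[of "{x. \<phi> x \<noteq> 0}"] by auto
qed (use assms C_k_coordinate_mult in \<open>auto simp: test_functions_def\<close>)

lemma test_functions_diff:
  assumes \<phi>: "\<phi> \<in> test_functions \<Omega>" and \<psi>: "\<psi> \<in> test_functions \<Omega>"
  shows "(\<lambda>x. \<phi> x - \<psi> x) \<in> test_functions \<Omega>"
proof (rule test_functionsI[where K = "closure {x. \<phi> x \<noteq> 0} \<union> closure {x. \<psi> x \<noteq> 0}"])
  show "C_k k (\<lambda>x. \<phi> x - \<psi> x)" for k
    using C_k_linear_combination[of k \<phi> \<psi> 1 "-1"] assms by (auto simp: test_functions_def)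
  show "\<phi> x - \<psi> x = 0" if "x \<notin> closure {x. \<phi> x \<noteq> 0} \<union> closure {x. \<psi> x \<noteq> 0}" for x
  proof -
    have "x \<notin> {x. \<phi> x \<noteq> 0}" "x \<notin> {x. \<psi> x \<noteq> 0}"
      using that by (meson UnI1 UnI2 closure_subset subsetD)+
    then show ?thesis by simp
  qed
qed (use assms in \<open>auto simp: test_functions_def simp del: compact_closure\<close>)

lemma test_function_differentiable: "\<phi> \<in> test_functions \<Omega> \<Longrightarrow> \<phi> differentiable at x"
  using C_k.simps(2)[of 0 \<phi>] by (auto simp: test_functions_def simp del: C_k.simps)

lemma continuous_on_test_function: "\<phi> \<in> test_functions \<Omega> \<Longrightarrow> continuous_on UNIV \<phi>"
  using C_k.simps(1)[of \<phi>] by (auto simp: test_functions_def simp del: C_k.simps)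

lemma continuous_on_gradient_test_function:
  assumes "\<phi> \<in> test_functions \<Omega>"
  shows "continuous_on UNIV (gradient \<phi>)"
proof -
  have "C_k (Suc 0) \<phi>"
    using assms by (simp add: test_functions_def del: C_k.simps)
  then show ?thesis
    unfolding gradient_def by (auto intro!: continuous_intros)
qed

lemma gradient_inner_Basis:
  "i \<in> Basis \<Longrightarrow> gradient \<phi> x \<bullet> i = frechet_derivative \<phi> (at x) i"
  by (simp add: gradient_def inner_sum_left inner_Basis if_distrib sum.delta cong: if_cong)

lemma gradient_diff:
  assumes "\<phi> differentiable at x" "\<psi> differentiable at x"
  shows "gradient (\<lambda>x. \<phi> x - \<psi> x) x = gradient \<phi> x - gradient \<psi> x"
proof -
  have "frechet_derivative (\<lambda>x. \<phi> x - \<psi> x) (at x) =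
      (\<lambda>i. frechet_derivative \<phi> (at x) i - frechet_derivative \<psi> (at x) i)"
    using assms by (intro frechet_derivative_at[symmetric] has_derivative_diff)
       (auto simp: frechet_derivative_works[symmetric])
  then show ?thesis
    by (simp add: gradient_def scaleR_diff_left sum_subtractf)
qed

lemma test_function_Lp_2:
  assumes \<Omega>: "open \<Omega>" "bounded \<Omega>" and \<phi>: "\<phi> \<in> test_functions \<Omega>"
  shows "\<phi> \<in> Lp 2 \<Omega>" "gradient \<phi> \<in> Lp 2 \<Omega>"
  by (intro continuous_Lp_2 \<Omega> continuous_on_test_function[OF \<phi>]
      continuous_on_gradient_test_function[OF \<phi>])+

section \<open>Weak gradients and the Poincare inequality\<close>

lemma has_H10_gradient_Lp_2:
  assumes "has_H10_gradient \<Omega> y g"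
  shows "y \<in> Lp 2 \<Omega>" "g \<in> Lp 2 \<Omega>"
  using assms by (auto simp: has_H10_gradient_def has_weak_gradient_def)

lemma has_weak_gradient_diff:
  assumes \<Omega>: "open \<Omega>" "bounded \<Omega>"
    and y: "has_weak_gradient \<Omega> y g" and z: "has_weak_gradient \<Omega> z k"
  shows "has_weak_gradient \<Omega> (\<lambda>x. y x - z x) (\<lambda>x. g x - k x)"
  unfolding has_weak_gradient_def
proof (intro conjI ballI)
  have L2: "y \<in> Lp 2 \<Omega>" "g \<in> Lp 2 \<Omega>" "z \<in> Lp 2 \<Omega>" "k \<in> Lp 2 \<Omega>"
    using y z by (auto simp: has_weak_gradient_def)
  then show "(\<lambda>x. y x - z x) \<in> Lp 2 \<Omega>" "(\<lambda>x. g x - k x) \<in> Lp 2 \<Omega>"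
    by (simp_all add: Lp_2_diff)
  fix \<phi> and i :: 'a assume \<phi>: "\<phi> \<in> test_functions \<Omega>" and i: "i \<in> Basis"
  have \<phi>L: "(\<lambda>x. \<phi> x *\<^sub>R i) \<in> Lp 2 \<Omega>"
    by (intro continuous_Lp_2 \<Omega> continuous_intros continuous_on_test_function[OF \<phi>])
  have dL: "(\<lambda>x. gradient \<phi> x \<bullet> i) \<in> Lp 2 \<Omega>"
    by (intro continuous_Lp_2 \<Omega> continuous_intros continuous_on_gradient_test_function[OF \<phi>])
  then have dL: "(\<lambda>x. frechet_derivative \<phi> (at x) i) \<in> Lp 2 \<Omega>"
    by (simp add: gradient_inner_Basis i)
  have "(\<integral>x. (y x - z x) * frechet_derivative \<phi> (at x) i \<partial>lebesgue_on \<Omega>) =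
      (\<integral>x. y x * frechet_derivative \<phi> (at x) i \<partial>lebesgue_on \<Omega>) -
      (\<integral>x. z x * frechet_derivative \<phi> (at x) i \<partial>lebesgue_on \<Omega>)"
    using integrable_mult_Lp_2[OF L2(1) dL] integrable_mult_Lp_2[OF L2(3) dL]
    by (simp add: left_diff_distrib)
  also have "\<dots> = - ((\<integral>x. (g x \<bullet> i) * \<phi> x \<partial>lebesgue_on \<Omega>) - (\<integral>x. (k x \<bullet> i) * \<phi> x \<partial>lebesgue_on \<Omega>))"
    using y z \<phi> i by (simp add: has_weak_gradient_def)
  also have "\<dots> = - (\<integral>x. ((g x - k x) \<bullet> i) * \<phi> x \<partial>lebesgue_on \<Omega>)"
    using integrable_inner_Lp_2[OF L2(2) \<phi>L] integrable_inner_Lp_2[OF L2(4) \<phi>L]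
    by (simp add: inner_diff_left right_diff_distrib mult.commute)
  finally show "(\<integral>x. (y x - z x) * frechet_derivative \<phi> (at x) i \<partial>lebesgue_on \<Omega>) =
      - (\<integral>x. ((g x - k x) \<bullet> i) * \<phi> x \<partial>lebesgue_on \<Omega>)" .
qed

lemma has_H10_gradient_diff:
  assumes \<Omega>: "open \<Omega>" "bounded \<Omega>"
    and y: "has_H10_gradient \<Omega> y g" and z: "has_H10_gradient \<Omega> z k"
  shows "has_H10_gradient \<Omega> (\<lambda>x. y x - z x) (\<lambda>x. g x - k x)"
proof -
  obtain \<phi> where \<phi>: "\<And>n. \<phi> n \<in> test_functions \<Omega>"
    "(\<lambda>n. Lp_norm 2 \<Omega> (\<lambda>x. \<phi> n x - y x)) \<longlonglongrightarrow> 0"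
    "(\<lambda>n. Lp_norm 2 \<Omega> (\<lambda>x. gradient (\<phi> n) x - g x)) \<longlonglongrightarrow> 0"
    using y by (auto simp: has_H10_gradient_def)
  obtain \<psi> where \<psi>: "\<And>n. \<psi> n \<in> test_functions \<Omega>"
    "(\<lambda>n. Lp_norm 2 \<Omega> (\<lambda>x. \<psi> n x - z x)) \<longlonglongrightarrow> 0"
    "(\<lambda>n. Lp_norm 2 \<Omega> (\<lambda>x. gradient (\<psi> n) x - k x)) \<longlonglongrightarrow> 0"
    using z by (auto simp: has_H10_gradient_def)
  note L2 = has_H10_gradient_Lp_2[OF y] has_H10_gradient_Lp_2[OF z]
    test_function_Lp_2[OF \<Omega> \<phi>(1)] test_function_Lp_2[OF \<Omega> \<psi>(1)]
  have "(\<lambda>n. Lp_norm 2 \<Omega> (\<lambda>x. (\<phi> n x - \<psi> n x) - (y x - z x))) \<longlonglongrightarrow> 0"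
    using Lp_norm_2_diff_tendsto_zero[OF Lp_2_diff Lp_2_diff \<phi>(2) \<psi>(2)] L2
    by (simp add: algebra_simps)
  moreover have "(\<lambda>n. Lp_norm 2 \<Omega> (\<lambda>x. gradient (\<lambda>x. \<phi> n x - \<psi> n x) x - (g x - k x))) \<longlonglongrightarrow> 0"
    using Lp_norm_2_diff_tendsto_zero[OF Lp_2_diff Lp_2_diff \<phi>(3) \<psi>(3)] L2 \<phi>(1) \<psi>(1)
    by (simp add: gradient_diff test_function_differentiable[OF \<phi>(1)]
        test_function_differentiable[OF \<psi>(1)] algebra_simps)
  ultimately show ?thesis
    using y z \<phi>(1) \<psi>(1) has_weak_gradient_diff[OF \<Omega>] test_functions_diff
    unfolding has_H10_gradient_def
    by (intro conjI exI[of _ "\<lambda>n x. \<phi> n x - \<psi> n x"]) blast+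
qed

text \<open>Integration by parts against a coordinate function. If \<open>\<phi>\<^sub>n\<close> are test functions approximating
  \<open>y\<close>, then \<open>x\<^sub>i \<phi>\<^sub>n\<close> is a test function as well, and the definition of the weak gradient \<open>g\<close> of \<open>y\<close> gives
  \<open>\<integral> y \<phi>\<^sub>n + \<integral> y x\<^sub>i \<partial>\<^sub>i \<phi>\<^sub>n = - \<integral> g\<^sub>i x\<^sub>i \<phi>\<^sub>n\<close>. In the limit \<open>\<integral> y\<^sup>2 = - 2 \<integral> x\<^sub>i y g\<^sub>i\<close>, and since
  \<open>\<bar>x\<^sub>i\<bar> \<le> R\<close> the right-hand side is at most \<open>2 R \<parallel>y\<parallel> \<parallel>g\<parallel>\<close>.\<close>

lemma Poincare_inequality:
  fixes \<Omega> :: "'a::euclidean_space set"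
  assumes \<Omega>: "open \<Omega>" "bounded \<Omega>" and R: "\<And>x. x \<in> \<Omega> \<Longrightarrow> norm x \<le> R" "0 \<le> R"
    and y: "has_H10_gradient \<Omega> y g"
  shows "Lp_norm 2 \<Omega> y \<le> 2 * R * Lp_norm 2 \<Omega> g"
proof -
  obtain i :: 'a where i: "i \<in> Basis"
    using nonempty_Basis by blast
  obtain \<phi> where \<phi>: "\<And>n. \<phi> n \<in> test_functions \<Omega>"
    "(\<lambda>n. Lp_norm 2 \<Omega> (\<lambda>x. \<phi> n x - y x)) \<longlonglongrightarrow> 0"
    "(\<lambda>n. Lp_norm 2 \<Omega> (\<lambda>x. gradient (\<phi> n) x - g x)) \<longlonglongrightarrow> 0"
    using y by (auto simp: has_H10_gradient_def)
  have yL: "y \<in> Lp 2 \<Omega>" and gL: "g \<in> Lp 2 \<Omega>"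
    using has_H10_gradient_Lp_2[OF y] by auto
  have \<phi>L: "\<phi> n \<in> Lp 2 \<Omega>" "gradient (\<phi> n) \<in> Lp 2 \<Omega>" for n
    by (intro test_function_Lp_2[OF \<Omega> \<phi>(1)])+
  have mi: "(\<lambda>x::'a. x \<bullet> i) \<in> borel_measurable (lebesgue_on \<Omega>)"
    using \<Omega>(1) by (intro continuous_imp_measurable_on_sets_lebesgue continuous_intros) simp
  have bi: "\<bar>x \<bullet> i\<bar> \<le> R" if "x \<in> \<Omega>" for x
    using Basis_le_norm[OF i, of x] R(1)[OF that] by simp
  define xg where "xg = (\<lambda>x. (x \<bullet> i) * (g x \<bullet> i))"
  have xg_le: "norm (xg x) \<le> R * norm (g x)" if "x \<in> \<Omega>" for x
    unfolding xg_def real_norm_def abs_mult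
    using bi[OF that] Basis_le_norm[OF i] R(2) by (intro mult_mono) auto
  have "xg \<in> borel_measurable (lebesgue_on \<Omega>)"
    unfolding xg_def using gL
    by (intro borel_measurable_times[OF mi] borel_measurable_inner) (simp_all add: Lp_2_iff)
  then have xgL: "xg \<in> Lp 2 \<Omega>"
    using xg_le by (rule Lp_2_dominated[OF gL])
  have yiL: "(\<lambda>x. ((x \<bullet> i) * y x) *\<^sub>R i) \<in> Lp 2 \<Omega>"
  proof (rule Lp_2_dominated[OF yL])
    show "(\<lambda>x. ((x \<bullet> i) * y x) *\<^sub>R i) \<in> borel_measurable (lebesgue_on \<Omega>)"
      using yL mi by (intro borel_measurable_scaleR borel_measurable_times) (simp_all add: Lp_2_iff)
    show "norm (((x \<bullet> i) * y x) *\<^sub>R i) \<le> R * norm (y x)" if "x \<in> \<Omega>" for x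
      using i bi[OF that] by (simp add: abs_mult mult_right_mono)
  qed
  have eq: "(\<integral>x. \<phi> n x \<bullet> y x \<partial>lebesgue_on \<Omega>) +
      (\<integral>x. gradient (\<phi> n) x \<bullet> (((x \<bullet> i) * y x) *\<^sub>R i) \<partial>lebesgue_on \<Omega>) =
      - (\<integral>x. \<phi> n x \<bullet> xg x \<partial>lebesgue_on \<Omega>)" for n
  proof -
    have "(\<integral>x. y x * frechet_derivative (\<lambda>x. (x \<bullet> i) * \<phi> n x) (at x) i \<partial>lebesgue_on \<Omega>) =
        - (\<integral>x. (g x \<bullet> i) * ((x \<bullet> i) * \<phi> n x) \<partial>lebesgue_on \<Omega>)"
      using y i test_functions_coordinate_mult[OF \<phi>(1), of i n]
      by (simp add: has_H10_gradient_def has_weak_gradient_def)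
    moreover have "y x * frechet_derivative (\<lambda>x. (x \<bullet> i) * \<phi> n x) (at x) i =
        \<phi> n x \<bullet> y x + gradient (\<phi> n) x \<bullet> (((x \<bullet> i) * y x) *\<^sub>R i)" for x
      using i by (simp add: frechet_derivative_coordinate_mult test_function_differentiable[OF \<phi>(1)]
          gradient_inner_Basis algebra_simps)
    ultimately show ?thesis
      using integrable_inner_Lp_2[OF \<phi>L(1) yL] integrable_inner_Lp_2[OF \<phi>L(2) yiL]
      by (simp add: xg_def mult_ac)
  qed
  have "(\<lambda>n. (\<integral>x. \<phi> n x \<bullet> y x \<partial>lebesgue_on \<Omega>) +
      (\<integral>x. gradient (\<phi> n) x \<bullet> (((x \<bullet> i) * y x) *\<^sub>R i) \<partial>lebesgue_on \<Omega>)) \<longlonglongrightarrow>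
      (\<integral>x. y x \<bullet> y x \<partial>lebesgue_on \<Omega>) + (\<integral>x. g x \<bullet> (((x \<bullet> i) * y x) *\<^sub>R i) \<partial>lebesgue_on \<Omega>)"
    by (intro tendsto_add tendsto_integral_inner_Lp_2 \<phi>L yL gL yiL \<phi>(2,3))
  moreover have "(\<lambda>n. - (\<integral>x. \<phi> n x \<bullet> xg x \<partial>lebesgue_on \<Omega>)) \<longlonglongrightarrow>
      - (\<integral>x. y x \<bullet> xg x \<partial>lebesgue_on \<Omega>)"
    by (intro tendsto_minus tendsto_integral_inner_Lp_2 \<phi>L yL \<phi>(2) xgL)
  ultimately have lim: "(\<integral>x. y x \<bullet> y x \<partial>lebesgue_on \<Omega>) +
      (\<integral>x. g x \<bullet> (((x \<bullet> i) * y x) *\<^sub>R i) \<partial>lebesgue_on \<Omega>) = - (\<integral>x. y x \<bullet> xg x \<partial>lebesgue_on \<Omega>)"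
    unfolding eq by (rule LIMSEQ_unique)
  define a where "a = Lp_norm 2 \<Omega> y"
  have a2: "a\<^sup>2 = (\<integral>x. y x \<bullet> y x \<partial>lebesgue_on \<Omega>)"
    by (simp only: a_def Lp_norm_2_square power2_norm_eq_inner)
  have gy: "g x \<bullet> (((x \<bullet> i) * y x) *\<^sub>R i) = y x \<bullet> xg x" for x
    by (simp add: xg_def mult_ac)
  have a2': "a\<^sup>2 = - 2 * (\<integral>x. y x \<bullet> xg x \<partial>lebesgue_on \<Omega>)"
    using lim unfolding gy a2 by linarith
  have "- (\<integral>x. y x \<bullet> xg x \<partial>lebesgue_on \<Omega>) \<le> a * Lp_norm 2 \<Omega> xg"
    unfolding a_def by (rule order_trans[OF abs_ge_minus_self Cauchy_Schwarz_Lp_2[OF yL xgL]])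
  also have "\<dots> \<le> a * (R * Lp_norm 2 \<Omega> g)"
    unfolding a_def
    by (intro mult_left_mono Lp_norm_2_dominated[OF gL xgL xg_le R(2)] Lp_norm_2_nonneg)
  finally have "a * a \<le> 2 * (a * (R * Lp_norm 2 \<Omega> g))"
    using a2' unfolding power2_eq_square by linarith
  also have "\<dots> = a * (2 * R * Lp_norm 2 \<Omega> g)"
    by simp
  finally have le: "a * a \<le> a * (2 * R * Lp_norm 2 \<Omega> g)" .
  show ?thesis
  proof (cases "a = 0")
    case True
    then show ?thesis
      using R(2) Lp_norm_2_nonneg[of \<Omega> g] by (simp add: a_def)
  next
    case False
    then have "0 < a"
      using Lp_norm_2_nonneg[of \<Omega> y] by (simp add: a_def)
    with le show ?thesis
      unfolding a_def by (rule mult_left_le_imp_le)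
  qed
qed

section \<open>Energy estimates for weak solutions\<close>

lemma weak_dirichlet_solution_Lp_2: "weak_dirichlet_solution \<Omega> y r f \<Longrightarrow> y \<in> Lp 2 \<Omega>"
  using has_H10_gradient_Lp_2 by (auto simp: weak_dirichlet_solution_def)

lemma weak_dirichlet_solution_diff:
  assumes \<Omega>: "open \<Omega>" "bounded \<Omega>"
    and y: "weak_dirichlet_solution \<Omega> y r f" and z: "weak_dirichlet_solution \<Omega> z s e"
    and L2: "r \<in> Lp 2 \<Omega>" "s \<in> Lp 2 \<Omega>" "f \<in> Lp 2 \<Omega>" "e \<in> Lp 2 \<Omega>"
  shows "weak_dirichlet_solution \<Omega> (\<lambda>x. y x - z x) (\<lambda>x. r x - s x) (\<lambda>x. f x - e x)"
proof -
  obtain g where g: "has_H10_gradient \<Omega> y g"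
    "\<And>v w. has_H10_gradient \<Omega> v w \<Longrightarrow>
      (\<integral>x. g x \<bullet> w x \<partial>lebesgue_on \<Omega>) + (\<integral>x. r x * v x \<partial>lebesgue_on \<Omega>)
        = (\<integral>x. f x * v x \<partial>lebesgue_on \<Omega>)"
    using y by (auto simp: weak_dirichlet_solution_def)
  obtain k where k: "has_H10_gradient \<Omega> z k"
    "\<And>v w. has_H10_gradient \<Omega> v w \<Longrightarrow>
      (\<integral>x. k x \<bullet> w x \<partial>lebesgue_on \<Omega>) + (\<integral>x. s x * v x \<partial>lebesgue_on \<Omega>)
        = (\<integral>x. e x * v x \<partial>lebesgue_on \<Omega>)"
    using z by (auto simp: weak_dirichlet_solution_def)
  have "(\<integral>x. (g x - k x) \<bullet> w x \<partial>lebesgue_on \<Omega>) + (\<integral>x. (r x - s x) * v x \<partial>lebesgue_on \<Omega>)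
        = (\<integral>x. (f x - e x) * v x \<partial>lebesgue_on \<Omega>)" if vw: "has_H10_gradient \<Omega> v w" for v w
  proof -
    note vL = has_H10_gradient_Lp_2[OF vw]
    note int = L2(1,2,3,4)[THEN integrable_mult_Lp_2, OF vL(1)]
      integrable_inner_Lp_2[OF has_H10_gradient_Lp_2(2)[OF g(1)] vL(2)]
      integrable_inner_Lp_2[OF has_H10_gradient_Lp_2(2)[OF k(1)] vL(2)]
    show ?thesis
      using int g(2)[OF vw] k(2)[OF vw] by (simp add: inner_diff_left left_diff_distrib)
  qed
  then show ?thesis
    using has_H10_gradient_diff[OF \<Omega> g(1) k(1)] unfolding weak_dirichlet_solution_def by blast
qed

text \<open>Reaction and source enter the weak formulation only through \<open>r - f\<close>, so terms may be moved
  from one to the other.\<close>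

lemma weak_dirichlet_solution_cong:
  assumes y: "weak_dirichlet_solution \<Omega> y r f"
    and eq: "\<And>x. s x - e x = r x - f x"
    and L2: "r \<in> Lp 2 \<Omega>" "s \<in> Lp 2 \<Omega>" "f \<in> Lp 2 \<Omega>" "e \<in> Lp 2 \<Omega>"
  shows "weak_dirichlet_solution \<Omega> y s e"
proof -
  have *: "(\<integral>x. s x * v x \<partial>lebesgue_on \<Omega>) - (\<integral>x. e x * v x \<partial>lebesgue_on \<Omega>) =
      (\<integral>x. r x * v x \<partial>lebesgue_on \<Omega>) - (\<integral>x. f x * v x \<partial>lebesgue_on \<Omega>)"
    if vw: "has_H10_gradient \<Omega> v w" for v w
  proof -
    note int = L2(1,2,3,4)[THEN integrable_mult_Lp_2, OF has_H10_gradient_Lp_2(1)[OF vw]]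
    have "(\<integral>x. s x * v x \<partial>lebesgue_on \<Omega>) - (\<integral>x. e x * v x \<partial>lebesgue_on \<Omega>) =
        (\<integral>x. (s x - e x) * v x \<partial>lebesgue_on \<Omega>)"
      using int by (simp add: left_diff_distrib)
    also have "\<dots> = (\<integral>x. r x * v x \<partial>lebesgue_on \<Omega>) - (\<integral>x. f x * v x \<partial>lebesgue_on \<Omega>)"
      using int by (simp add: eq left_diff_distrib)
    finally show ?thesis .
  qed
  have eq': "a + (\<integral>x. r x * v x \<partial>lebesgue_on \<Omega>) = (\<integral>x. f x * v x \<partial>lebesgue_on \<Omega>) \<longleftrightarrow>
      a + (\<integral>x. s x * v x \<partial>lebesgue_on \<Omega>) = (\<integral>x. e x * v x \<partial>lebesgue_on \<Omega>)"
    if "has_H10_gradient \<Omega> v w" for a v w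
    using that[THEN *] by linarith
  obtain g where "has_H10_gradient \<Omega> y g"
    "\<And>v w. has_H10_gradient \<Omega> v w \<Longrightarrow>
      (\<integral>x. g x \<bullet> w x \<partial>lebesgue_on \<Omega>) + (\<integral>x. r x * v x \<partial>lebesgue_on \<Omega>)
        = (\<integral>x. f x * v x \<partial>lebesgue_on \<Omega>)"
    using y by (auto simp: weak_dirichlet_solution_def)
  then show ?thesis
    unfolding weak_dirichlet_solution_def using eq' by (intro exI[of _ g]) blast
qed

text \<open>Testing the equation with the solution itself gives \<open>\<parallel>\<nabla>v\<parallel>\<^sup>2 \<le> \<integral> f v \<le> \<parallel>f\<parallel> \<parallel>v\<parallel>\<close>, because the
  reaction term has a sign; the Poincare inequality turns this into a bound on \<open>\<parallel>v\<parallel>\<close>. Applied to a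
  difference of two solutions, the estimate yields both uniqueness for the linearized equation and
  Lipschitz dependence on the data for the semilinear one.\<close>

lemma energy_estimate:
  assumes \<Omega>: "open \<Omega>" "bounded \<Omega>" and R: "\<And>x. x \<in> \<Omega> \<Longrightarrow> norm x \<le> R" "0 \<le> R"
    and v: "weak_dirichlet_solution \<Omega> v r f"
    and L2: "r \<in> Lp 2 \<Omega>" "f \<in> Lp 2 \<Omega>"
    and mono: "\<And>x. 0 \<le> r x * v x"
  shows "Lp_norm 2 \<Omega> v \<le> 4 * R\<^sup>2 * Lp_norm 2 \<Omega> f"
proof -
  obtain g where g: "has_H10_gradient \<Omega> v g"
    "\<And>z w. has_H10_gradient \<Omega> z w \<Longrightarrow>
      (\<integral>x. g x \<bullet> w x \<partial>lebesgue_on \<Omega>) + (\<integral>x. r x * z x \<partial>lebesgue_on \<Omega>)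
        = (\<integral>x. f x * z x \<partial>lebesgue_on \<Omega>)"
    using v by (auto simp: weak_dirichlet_solution_def)
  define a b c where "a = Lp_norm 2 \<Omega> v" and "b = Lp_norm 2 \<Omega> f" and "c = Lp_norm 2 \<Omega> g"
  have nonneg: "0 \<le> a" "0 \<le> b" "0 \<le> c"
    by (simp_all add: a_def b_def c_def Lp_norm_2_nonneg)
  have "0 \<le> (\<integral>x. r x * v x \<partial>lebesgue_on \<Omega>)"
    using mono by (intro integral_nonneg_AE) auto
  then have "c\<^sup>2 \<le> (\<integral>x. f x * v x \<partial>lebesgue_on \<Omega>)"
    using g(2)[OF g(1)] by (simp add: c_def Lp_norm_2_square power2_norm_eq_inner)
  also have "\<dots> \<le> b * a"
    using Cauchy_Schwarz_Lp_2[OF L2(2) has_H10_gradient_Lp_2(1)[OF g(1)]] by (simp add: a_def b_def)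
  finally have cab: "c\<^sup>2 \<le> b * a" .
  have "a \<le> 2 * R * c"
    unfolding a_def c_def by (rule Poincare_inequality[OF \<Omega> R g(1)])
  then have "a\<^sup>2 \<le> (2 * R * c)\<^sup>2"
    using nonneg by (intro power_mono) auto
  also have "\<dots> = 4 * R\<^sup>2 * c\<^sup>2"
    by (simp add: power_mult_distrib)
  also have "\<dots> \<le> 4 * R\<^sup>2 * (b * a)"
    using cab by (intro mult_left_mono) auto
  finally have "a * a \<le> a * (4 * R\<^sup>2 * b)"
    by (simp add: power2_eq_square algebra_simps)
  then show ?thesis
    using nonneg unfolding a_def[symmetric] b_def[symmetric] by (cases "a = 0") auto
qed

lemma semilinear_solution_Lipschitz:
  assumes \<Omega>: "open \<Omega>" "bounded \<Omega>" and R: "\<And>x. x \<in> \<Omega> \<Longrightarrow> norm x \<le> R" "0 \<le> R"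
    and y: "weak_dirichlet_solution \<Omega> y (\<lambda>x. max (y x) 0) u"
    and z: "weak_dirichlet_solution \<Omega> z (\<lambda>x. max (z x) 0) v"
    and L2: "u \<in> Lp 2 \<Omega>" "v \<in> Lp 2 \<Omega>"
  shows "Lp_norm 2 \<Omega> (\<lambda>x. y x - z x) \<le> 4 * R\<^sup>2 * Lp_norm 2 \<Omega> (\<lambda>x. u x - v x)"
proof (rule energy_estimate[OF \<Omega> R])
  note m = max_zero_Lp_2[OF weak_dirichlet_solution_Lp_2[OF y]]
    max_zero_Lp_2[OF weak_dirichlet_solution_Lp_2[OF z]]
  show "weak_dirichlet_solution \<Omega> (\<lambda>x. y x - z x) (\<lambda>x. max (y x) 0 - max (z x) 0) (\<lambda>x. u x - v x)"
    by (rule weak_dirichlet_solution_diff[OF \<Omega> y z m L2])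
  show "(\<lambda>x. max (y x) 0 - max (z x) 0) \<in> Lp 2 \<Omega>" "(\<lambda>x. u x - v x) \<in> Lp 2 \<Omega>"
    by (intro Lp_2_diff m L2)+
  show "0 \<le> (max (y x) 0 - max (z x) 0) * (y x - z x)" for x
    by (cases "y x \<le> z x") (auto intro: mult_nonneg_nonneg mult_nonpos_nonpos)
qed

section \<open>Measure estimates\<close>

lemma Chebyshev_Lp_2:
  fixes f :: "'a::euclidean_space \<Rightarrow> real"
  assumes f: "f \<in> Lp 2 \<Omega>" and \<epsilon>: "0 < \<epsilon>"
  shows "measure (lebesgue_on \<Omega>) {x \<in> \<Omega>. \<epsilon> \<le> \<bar>f x\<bar>} \<le> (Lp_norm 2 \<Omega> f)\<^sup>2 / \<epsilon>\<^sup>2"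
proof -
  have "measure (lebesgue_on \<Omega>) {x \<in> space (lebesgue_on \<Omega>). \<epsilon>\<^sup>2 \<le> (norm (f x))\<^sup>2} \<le>
      (\<integral>x. (norm (f x))\<^sup>2 \<partial>lebesgue_on \<Omega>) / \<epsilon>\<^sup>2"
    using f \<epsilon> by (intro integral_Markov_inequality_measure[where A = "{}"]) (auto simp: Lp_2_iff)
  moreover have "{x \<in> \<Omega>. \<epsilon> \<le> \<bar>f x\<bar>} = {x \<in> \<Omega>. \<epsilon>\<^sup>2 \<le> (norm (f x))\<^sup>2}"
    using \<epsilon> abs_le_square_iff[of \<epsilon>] by auto
  ultimately show ?thesis
    by (simp add: Lp_norm_2_square)
qed

lemma measure_sublevel_tendsto_zero_set:
  fixes y :: "'a::euclidean_space \<Rightarrow> real"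
  assumes \<Omega>: "\<Omega> \<in> lmeasurable" and y: "y \<in> borel_measurable (lebesgue_on \<Omega>)"
  shows "(\<lambda>n. measure (lebesgue_on \<Omega>) {x \<in> \<Omega>. \<bar>y x\<bar> \<le> 1 / real (Suc n)}) \<longlonglongrightarrow>
    measure (lebesgue_on \<Omega>) {x \<in> \<Omega>. y x = 0}"
proof -
  interpret finite_measure "lebesgue_on \<Omega>"
    by (rule finite_measure_lebesgue_on[OF \<Omega>])
  let ?E = "\<lambda>n::nat. {x \<in> \<Omega>. \<bar>y x\<bar> \<le> 1 / real (Suc n)}"
  have "{x \<in> space (lebesgue_on \<Omega>). \<bar>y x\<bar> \<le> 1 / real (Suc n)} \<in> sets (lebesgue_on \<Omega>)" for n
    using y by measurable
  then have "range ?E \<subseteq> sets (lebesgue_on \<Omega>)"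
    by auto
  moreover have "decseq ?E"
  proof (rule decseq_SucI, safe)
    fix n x assume "\<bar>y x\<bar> \<le> 1 / real (Suc (Suc n))"
    also have "\<dots> \<le> 1 / real (Suc n)"
      by (intro divide_left_mono) auto
    finally show "\<bar>y x\<bar> \<le> 1 / real (Suc n)" .
  qed
  ultimately have "(\<lambda>n. measure (lebesgue_on \<Omega>) (?E n)) \<longlonglongrightarrow> measure (lebesgue_on \<Omega>) (\<Inter>n. ?E n)"
    by (rule finite_Lim_measure_decseq)
  also have "(\<Inter>n. ?E n) = {x \<in> \<Omega>. y x = 0}"
  proof (intro equalityI subsetI)
    fix x assume x: "x \<in> (\<Inter>n. ?E n)"
    have "\<bar>y x\<bar> \<le> 0"
      using x by (intro LIMSEQ_le_const[OF LIMSEQ_Suc[OF lim_1_over_n]]) auto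
    then show "x \<in> {x \<in> \<Omega>. y x = 0}"
      using x by auto
  qed auto
  finally show ?thesis .
qed

text \<open>Hoelder's inequality for \<open>1\<^sub>S f\<close> with the conjugate exponents \<open>2 / p\<close> and \<open>2 / (2 - p)\<close>. It is the
  step that converts a small set into a small constant.\<close>

lemma Hoelder_on_small_set:
  fixes f h :: "'a::euclidean_space \<Rightarrow> real"
  assumes p: "0 < p" "p < 2" and \<Omega>: "\<Omega> \<in> lmeasurable"
    and f: "f \<in> Lp 2 \<Omega>" and S: "S \<in> sets (lebesgue_on \<Omega>)"
    and h: "h \<in> borel_measurable (lebesgue_on \<Omega>)"
    and le: "\<And>x. x \<in> \<Omega> \<Longrightarrow> \<bar>h x\<bar> \<le> indicator S x * \<bar>f x\<bar>"
  shows "h \<in> Lp p \<Omega>"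
    and "Lp_norm p \<Omega> h \<le> measure (lebesgue_on \<Omega>) S powr (1 / p - 1 / 2) * Lp_norm 2 \<Omega> f"
proof -
  let ?M = "lebesgue_on \<Omega>"
  interpret finite_measure ?M
    by (rule finite_measure_lebesgue_on[OF \<Omega>])
  define A s where "A = (\<integral>x. (f x)\<^sup>2 \<partial>?M)" and "s = measure ?M S"
  have As: "0 \<le> A" "0 \<le> s"
    by (simp_all add: A_def s_def)
  \<comment> \<open>Young's inequality for \<open>t f\<^sup>2\<close> and \<open>1\<close>; \<open>t\<close> is optimised after integration\<close>
  let ?B = "\<lambda>t x. t powr (- (p / 2)) * (p / 2 * (t * (f x)\<^sup>2) + (1 - p / 2) * indicator S x)"
  have fi: "integrable ?M (\<lambda>x. (f x)\<^sup>2)"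
    using f by (simp add: Lp_2_iff)
  have Bint: "integrable ?M (?B t)" for t
    using fi S by (intro integrable_mult_right Bochner_Integration.integrable_add) (auto simp: emeasure_eq_measure)
  have young: "\<bar>h x\<bar> powr p \<le> ?B t x" if t: "0 < t" and x: "x \<in> \<Omega>" for t x
  proof (cases "x \<in> S \<and> f x \<noteq> 0")
    case True
    have "\<bar>h x\<bar> powr p \<le> \<bar>f x\<bar> powr p"
      using le[OF x] True p by (intro powr_mono2) auto
    also have "\<dots> = t powr (- (p / 2)) * ((t * (f x)\<^sup>2) powr (p / 2) * 1 powr (1 - p / 2))"
    proof -
      have "(f x)\<^sup>2 = \<bar>f x\<bar> powr 2"
        by simp
      then have "((f x)\<^sup>2) powr (p / 2) = \<bar>f x\<bar> powr p"
        by (simp only: powr_powr) simp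
      then show ?thesis
        using t by (simp add: powr_mult mult.assoc[symmetric] flip: powr_add)
    qed
    also have "\<dots> \<le> t powr (- (p / 2)) * (p / 2 * (t * (f x)\<^sup>2) + (1 - p / 2) * 1)"
      using t True p by (intro mult_left_mono Youngs_inequality_0) auto
    finally show ?thesis
      using True by simp
  next
    case False
    then have "h x = 0"
      using le[OF x] by (auto simp: indicator_def split: if_splits)
    moreover have "0 \<le> ?B t x"
      using t p by (auto simp: indicator_def)
    ultimately show ?thesis
      by simp
  qed
  have hm: "(\<lambda>x. \<bar>h x\<bar> powr p) \<in> borel_measurable ?M"
    using h by measurable
  have hint: "integrable ?M (\<lambda>x. \<bar>h x\<bar> powr p)"
  proof (rule Bochner_Integration.integrable_bound[OF Bint[of 1] hm], rule AE_I2)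
    fix x assume "x \<in> space ?M"
    then show "norm (\<bar>h x\<bar> powr p) \<le> norm (?B 1 x)"
      using young[of 1 x] by simp
  qed
  then show "h \<in> Lp p \<Omega>"
    using h by (simp add: Lp_def)
  have I: "(\<integral>x. \<bar>h x\<bar> powr p \<partial>?M) \<le> s powr (1 - p / 2) * A powr (p / 2)"
  proof (cases "A = 0 \<or> s = 0")
    case True
    have "AE x in ?M. h x = 0"
      using True
    proof
      assume "A = 0"
      then have "AE x in ?M. (f x)\<^sup>2 = 0"
        using integral_nonneg_eq_0_iff_AE[OF fi] by (simp add: A_def)
      then show ?thesis
        by (rule AE_mp) (intro AE_I2 impI, use le in force)
    next
      assume "s = 0"
      then have "S \<in> null_sets ?M"
        using S by (simp add: null_sets_def emeasure_eq_measure s_def)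
      then show ?thesis
        by (rule AE_mp[OF AE_not_in]) (intro AE_I2 impI, use le in force)
    qed
    then have "(\<integral>x. \<bar>h x\<bar> powr p \<partial>?M) = (\<integral>x. 0 \<partial>?M)"
      using hm by (intro integral_cong_AE) auto
    then show ?thesis
      by simp
  next
    case False
    \<comment> \<open>balances the integrals of \<open>t f\<^sup>2\<close> and of the indicator of \<open>S\<close>\<close>
    define t where "t = s / A"
    have t: "0 < t"
      using False As by (simp add: t_def)
    have "(\<integral>x. \<bar>h x\<bar> powr p \<partial>?M) \<le> (\<integral>x. ?B t x \<partial>?M)"
      using young[OF t] by (intro integral_mono hint Bint) auto
    also have "\<dots> = t powr (- (p / 2)) * (p / 2 * (t * A) + (1 - p / 2) * s)"
      using fi S sets.sets_into_space[OF S]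
      by (simp add: A_def s_def emeasure_eq_measure Int_absorb2 measure_restrict_space)
    also have "p / 2 * (t * A) + (1 - p / 2) * s = s"
      using False by (simp add: t_def algebra_simps)
    also have "t powr (- (p / 2)) * s = s powr (1 - p / 2) * A powr (p / 2)"
    proof -
      have "t powr (- (p / 2)) = A powr (p / 2) * s powr (- (p / 2))"
        using False As by (simp add: t_def powr_minus powr_divide inverse_eq_divide)
      moreover have "s powr (1 - p / 2) = s * s powr (- (p / 2))"
        using False As powr_add[of s 1 "- (p / 2)"] by simp
      ultimately show ?thesis
        by simp
    qed
    finally show ?thesis .
  qed
  have "Lp_norm p \<Omega> h \<le> (s powr (1 - p / 2) * A powr (p / 2)) powr (1 / p)"
    unfolding Lp_norm_def real_norm_def using I p by (intro powr_mono2) auto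
  also have "\<dots> = s powr (1 / p - 1 / 2) * A powr (1 / 2)"
    using p As by (simp add: powr_mult powr_powr diff_divide_distrib)
  also have "A powr (1 / 2) = Lp_norm 2 \<Omega> f"
    using As by (simp add: Lp_norm_2 A_def powr_half_sqrt)
  finally show "Lp_norm p \<Omega> h \<le> measure ?M S powr (1 / p - 1 / 2) * Lp_norm 2 \<Omega> f"
    by (simp add: s_def)
qed

lemma Lp_norm_2_le_sup_norm:
  assumes \<Omega>: "open \<Omega>" "bounded \<Omega>" and y: "continuous_on (closure \<Omega>) y" "y \<in> Lp 2 \<Omega>"
  shows "Lp_norm 2 \<Omega> y \<le> measure lebesgue \<Omega> powr (1 / 2) * sup_norm \<Omega> y"
proof -
  have lm: "\<Omega> \<in> lmeasurable"
    using \<Omega> by (intro lmeasurable_open)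
  interpret finite_measure "lebesgue_on \<Omega>"
    by (rule finite_measure_lebesgue_on[OF lm])
  have "compact ((\<lambda>x. \<bar>y x\<bar>) ` closure \<Omega>)"
    using \<Omega> y(1) by (intro compact_continuous_image continuous_on_rabs) (auto simp: compact_closure)
  then have bdd: "bdd_above ((\<lambda>x. \<bar>y x\<bar>) ` closure \<Omega>)"
    by (intro bounded_imp_bdd_above compact_imp_bounded)
  have le: "\<bar>y x\<bar> \<le> sup_norm \<Omega> y" if "x \<in> \<Omega>" for x
    unfolding sup_norm_def using that closure_subset by (intro cSUP_upper bdd) auto
  show ?thesis
  proof (cases "\<Omega> = {}")
    case True
    then show ?thesis
      by (simp add: Lp_norm_2 integral_restrict_space)
  next
    case False
    then have pos: "0 \<le> sup_norm \<Omega> y"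
      using le abs_ge_zero order_trans by blast
    have "(norm (y x))\<^sup>2 \<le> (sup_norm \<Omega> y)\<^sup>2" if "x \<in> \<Omega>" for x
      using le[OF that] by (intro power_mono) auto
    then have "(\<integral>x. (norm (y x))\<^sup>2 \<partial>lebesgue_on \<Omega>) \<le> (\<integral>x. (sup_norm \<Omega> y)\<^sup>2 \<partial>lebesgue_on \<Omega>)"
      using y(2) by (intro integral_mono) (auto simp: Lp_2_iff)
    also have "\<dots> = (sup_norm \<Omega> y)\<^sup>2 * measure lebesgue \<Omega>"
      using \<Omega>(1) by (simp add: measure_restrict_space)
    finally have "Lp_norm 2 \<Omega> y \<le> sqrt ((sup_norm \<Omega> y)\<^sup>2 * measure lebesgue \<Omega>)"
      by (simp add: Lp_norm_2)
    then show ?thesis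
      using pos by (simp add: real_sqrt_mult powr_half_sqrt mult.commute)
  qed
qed

section \<open>The linearization error\<close>

lemma solution_operator_Lp_2:
  assumes "is_solution_operator \<Omega> F" "u \<in> Lp 2 \<Omega>"
  shows "weak_dirichlet_solution \<Omega> (F u) (\<lambda>x. max (F u x) 0) u" "F u \<in> Lp 2 \<Omega>"
proof -
  show "weak_dirichlet_solution \<Omega> (F u) (\<lambda>x. max (F u x) 0) u"
    using assms unfolding is_solution_operator_def by blast
  then show "F u \<in> Lp 2 \<Omega>"
    by (rule weak_dirichlet_solution_Lp_2)
qed

lemma sign_change_set_measurable:
  fixes f g :: "'a::euclidean_space \<Rightarrow> real"
  assumes f: "f \<in> Lp 2 \<Omega>" and g: "g \<in> Lp 2 \<Omega>"
  shows "{x \<in> \<Omega>. (f x > 0) \<noteq> (g x > 0)} \<in> sets (lebesgue_on \<Omega>)"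
proof -
  have [measurable]: "f \<in> borel_measurable (lebesgue_on \<Omega>)" "g \<in> borel_measurable (lebesgue_on \<Omega>)"
    using f g by (simp_all add: Lp_2_iff)
  have "{x \<in> space (lebesgue_on \<Omega>). (f x > 0) \<noteq> (g x > 0)} \<in> sets (lebesgue_on \<Omega>)"
    by measurable
  then show ?thesis
    by simp
qed

text \<open>Subtracting the three equations shows that the linearization error \<open>w\<close> satisfies
  \<open>-\<Delta>w + 1[F u > 0] w = h\<close> with \<open>h = 1[F u > 0] \<delta> - ((F uhat)\<^sup>+ - (F u)\<^sup>+)\<close> and \<open>\<delta> = F uhat - F u\<close>, so that
  \<open>w = G u h\<close> almost everywhere. The positive part is linear on each half-line, hence \<open>h\<close> vanishes
  unless exactly one of \<open>F u\<close> and \<open>F uhat\<close> is positive, and there \<open>\<bar>h\<bar> \<le> \<bar>\<delta>\<bar>\<close>. The bound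
  follows from the sup-norm estimate for \<open>G u\<close> and Hoelder's inequality on that set.\<close>

lemma linearization_error_le:
  fixes \<Omega> :: "'a::euclidean_space set"
  assumes \<Omega>: "open \<Omega>" "bounded \<Omega>"
    and F: "is_solution_operator \<Omega> F" and G: "is_linearized_operator \<Omega> F G"
    and p: "real DIM('a) / 2 < p" "p < 2"
    and L: "0 \<le> L" "\<And>h. h \<in> Lp p \<Omega> \<Longrightarrow>
      continuous_on (closure \<Omega>) (G u h) \<and> sup_norm \<Omega> (G u h) \<le> L * Lp_norm p \<Omega> h"
    and u: "u \<in> Lp 2 \<Omega>" and uh: "uhat \<in> Lp 2 \<Omega>"
  shows "Lp_norm 2 \<Omega> (\<lambda>x. F uhat x - F u x - G u (\<lambda>z. uhat z - u z) x) \<le>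
    L * measure lebesgue \<Omega> powr (1 / 2) *
    measure (lebesgue_on \<Omega>) {x \<in> \<Omega>. (F u x > 0) \<noteq> (F uhat x > 0)} powr (1 / p - 1 / 2) *
    Lp_norm 2 \<Omega> (\<lambda>x. F uhat x - F u x)"
proof -
  let ?M = "lebesgue_on \<Omega>"
  obtain R where R: "\<And>x. x \<in> \<Omega> \<Longrightarrow> norm x \<le> R" "0 < R"
    using \<Omega>(2) unfolding bounded_pos by blast
  have p0: "0 < p"
    using p(1) by (rule le_less_trans[rotated]) simp
  have lm: "\<Omega> \<in> lmeasurable"
    using \<Omega> by (intro lmeasurable_open)
  note F_sol = solution_operator_Lp_2(1)[OF F] and FL = solution_operator_Lp_2(2)[OF F]
  have F_meas [measurable]: "F u \<in> borel_measurable ?M" "F uhat \<in> borel_measurable ?M"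
    using FL[OF u] FL[OF uh] by (simp_all add: Lp_2_iff)
  define \<delta> where "\<delta> = (\<lambda>x. F uhat x - F u x)"
  have \<delta>L: "\<delta> \<in> Lp 2 \<Omega>"
    unfolding \<delta>_def by (intro Lp_2_diff FL u uh)
  define S where "S = {x \<in> \<Omega>. (F u x > 0) \<noteq> (F uhat x > 0)}"
  have S: "S \<in> sets ?M"
    unfolding S_def by (rule sign_change_set_measurable[OF FL[OF u] FL[OF uh]])
  define \<theta> :: "'a \<Rightarrow> real" where "\<theta> = (\<lambda>x. indicator {z. F u z > 0} x)"
  define h where "h = (\<lambda>x. \<theta> x * \<delta> x - (max (F uhat x) 0 - max (F u x) 0))"
  have \<theta>: "0 \<le> \<theta> x" "\<bar>\<theta> x\<bar> \<le> 1" for x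
    by (auto simp: \<theta>_def indicator_def)
  have \<theta>_meas [measurable]: "\<theta> \<in> borel_measurable ?M"
  proof -
    have "(\<lambda>x. if 0 < F u x then 1 else 0 :: real) \<in> borel_measurable ?M"
      by measurable
    moreover have "(\<lambda>x. if 0 < F u x then 1 else 0) = \<theta>"
      by (auto simp: \<theta>_def indicator_def)
    ultimately show ?thesis
      by (simp only:)
  qed
  have h_le: "\<bar>h x\<bar> \<le> indicator S x * \<bar>\<delta> x\<bar>" if "x \<in> \<Omega>" for x
    using that by (auto simp: h_def \<theta>_def \<delta>_def S_def indicator_def)
  have h_meas: "h \<in> borel_measurable ?M"
    unfolding h_def \<delta>_def by measurable
  have hL2: "h \<in> Lp 2 \<Omega>"
  proof (rule Lp_2_dominated[OF \<delta>L h_meas])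
    fix x assume x: "x \<in> \<Omega>"
    have "indicator S x * \<bar>\<delta> x\<bar> \<le> 1 * \<bar>\<delta> x\<bar>"
      by (intro mult_right_mono) (auto simp: indicator_def)
    then show "norm (h x) \<le> 1 * norm (\<delta> x)"
      using h_le[OF x] by simp
  qed
  have hLp: "h \<in> Lp p \<Omega>"
    and h_norm: "Lp_norm p \<Omega> h \<le> measure ?M S powr (1 / p - 1 / 2) * Lp_norm 2 \<Omega> \<delta>"
    by (rule Hoelder_on_small_set[OF p0 p(2) lm \<delta>L S h_meas h_le], assumption)+
  have G_sol: "weak_dirichlet_solution \<Omega> (G u k) (\<lambda>x. \<theta> x * G u k x) k" if "k \<in> Lp 2 \<Omega>" for k
  proof -
    have "real DIM('a) / 2 < 2 \<and> (2::real) \<le> 2"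
      using p by simp
    then show ?thesis
      using G u that unfolding is_linearized_operator_def \<theta>_def by blast
  qed
  define d where "d = (\<lambda>z. uhat z - u z)"
  have dL: "d \<in> Lp 2 \<Omega>"
    unfolding d_def by (rule Lp_2_diff[OF uh u])
  have \<theta>L: "(\<lambda>x. \<theta> x * f x) \<in> Lp 2 \<Omega>" if "f \<in> Lp 2 \<Omega>" for f
  proof (rule Lp_2_dominated[OF that])
    show "(\<lambda>x. \<theta> x * f x) \<in> borel_measurable ?M"
      using that by (intro borel_measurable_times \<theta>_meas) (simp add: Lp_2_iff)
    show "norm (\<theta> x * f x) \<le> 1 * norm (f x)" for x
      unfolding real_norm_def abs_mult by (intro mult_right_mono \<theta>) simp
  qed
  note mL = max_zero_Lp_2[OF FL[OF u]] max_zero_Lp_2[OF FL[OF uh]]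
  have GL: "G u k \<in> Lp 2 \<Omega>" if "k \<in> Lp 2 \<Omega>" for k
    by (rule weak_dirichlet_solution_Lp_2[OF G_sol[OF that]])
  define w where "w = (\<lambda>x. F uhat x - F u x - G u d x)"
  have wL: "w \<in> Lp 2 \<Omega>"
    unfolding w_def by (intro Lp_2_diff FL u uh GL dL)
  \<comment> \<open>\<open>z\<close> solves the homogeneous linearized equation and therefore vanishes almost everywhere\<close>
  define z where "z = (\<lambda>x. w x - G u h x)"
  have zL: "z \<in> Lp 2 \<Omega>"
    unfolding z_def by (intro Lp_2_diff wL GL hL2)
  note m = Lp_2_diff[OF mL(2,1)]
  note sol1 = weak_dirichlet_solution_diff[OF \<Omega> F_sol[OF uh] F_sol[OF u] mL(2,1) uh u]
  note sol2 = weak_dirichlet_solution_diff[OF \<Omega> sol1 G_sol[OF dL] m \<theta>L[OF GL[OF dL]]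
      Lp_2_diff[OF uh u] dL]
  note sol3 = weak_dirichlet_solution_diff[OF \<Omega> sol2 G_sol[OF hL2] Lp_2_diff[OF m \<theta>L[OF GL[OF dL]]]
      \<theta>L[OF GL[OF hL2]] Lp_2_diff[OF Lp_2_diff[OF uh u] dL] hL2]
  have sol: "weak_dirichlet_solution \<Omega> z (\<lambda>x. \<theta> x * z x) (\<lambda>x. 0)"
    unfolding z_def w_def
  proof (rule weak_dirichlet_solution_cong[OF sol3])
    show "\<theta> x * (F uhat x - F u x - G u d x - G u h x) - 0 =
        ((max (F uhat x) 0 - max (F u x) 0) - \<theta> x * G u d x) - \<theta> x * G u h x -
        (((uhat x - u x) - d x) - h x)" for x
      by (simp add: h_def d_def \<delta>_def algebra_simps)
    show "(\<lambda>x. \<theta> x * (F uhat x - F u x - G u d x - G u h x)) \<in> Lp 2 \<Omega>"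
      using \<theta>L[OF zL] by (simp add: z_def w_def)
  qed (intro Lp_2_diff m \<theta>L GL dL hL2 u uh zero_Lp_2)+
  have "Lp_norm 2 \<Omega> z \<le> 4 * R\<^sup>2 * Lp_norm 2 \<Omega> (\<lambda>x::'a. 0 :: real)"
  proof (rule energy_estimate[OF \<Omega> R(1) less_imp_le[OF R(2)] sol \<theta>L[OF zL] zero_Lp_2])
    show "0 \<le> \<theta> x * z x * z x" for x
      using \<theta>(1)[of x] by (simp add: mult.assoc)
  qed
  also have "\<dots> = 0"
    by (simp add: Lp_norm_2)
  finally have z0: "Lp_norm 2 \<Omega> z \<le> 0" .
  have "w = (\<lambda>x. z x - (0 - G u h x))"
    by (simp add: z_def)
  then have "Lp_norm 2 \<Omega> w \<le> Lp_norm 2 \<Omega> z + Lp_norm 2 \<Omega> (\<lambda>x. 0 - G u h x)"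
    using Lp_norm_2_triangle_diff[OF zL Lp_2_diff[OF zero_Lp_2 GL[OF hL2]]] by simp
  also have "\<dots> \<le> Lp_norm 2 \<Omega> (G u h)"
    using z0 by (simp add: Lp_norm_2)
  also have "\<dots> \<le> measure lebesgue \<Omega> powr (1 / 2) * sup_norm \<Omega> (G u h)"
    using L(2)[OF hLp] GL[OF hL2] by (intro Lp_norm_2_le_sup_norm \<Omega>) auto
  also have "\<dots> \<le> measure lebesgue \<Omega> powr (1 / 2) *
      (L * (measure ?M S powr (1 / p - 1 / 2) * Lp_norm 2 \<Omega> \<delta>))"
  proof (rule mult_left_mono)
    have "sup_norm \<Omega> (G u h) \<le> L * Lp_norm p \<Omega> h"
      using L(2)[OF hLp] by simp
    also have "\<dots> \<le> L * (measure ?M S powr (1 / p - 1 / 2) * Lp_norm 2 \<Omega> \<delta>)"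
      by (rule mult_left_mono[OF h_norm L(1)])
    finally show "sup_norm \<Omega> (G u h) \<le> L * (measure ?M S powr (1 / p - 1 / 2) * Lp_norm 2 \<Omega> \<delta>)" .
  qed simp
  finally show ?thesis
    by (simp add: w_def d_def \<delta>_def S_def mult_ac)
qed

text \<open>If \<open>F u\<close> and \<open>F uhat\<close> are both within \<open>\<epsilon>\<close> of \<open>F ubar\<close> at a point where \<open>\<bar>F ubar\<bar> > \<epsilon>\<close>, then both have
  the sign of \<open>F ubar\<close> there. So a sign change forces \<open>\<bar>F ubar\<bar> \<le> \<epsilon>\<close> or a deviation of at least \<open>\<epsilon>\<close>. The
  first set shrinks to the zero set of \<open>F ubar\<close> as \<open>\<epsilon>\<close> tends to zero; for fixed \<open>\<epsilon>\<close>, the deviation sets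
  are small by Chebyshev's inequality, since \<open>F\<close> is Lipschitz from \<open>L\<^sup>2\<close> to \<open>L\<^sup>2\<close>.\<close>

lemma measure_sign_change_set_le:
  fixes \<Omega> :: "'a::euclidean_space set"
  assumes \<Omega>: "open \<Omega>" "bounded \<Omega>" and F: "is_solution_operator \<Omega> F"
    and ub: "ubar \<in> Lp 2 \<Omega>" and \<eta>: "0 < \<eta>"
  shows "\<exists>\<rho>>0. \<forall>u \<in> L2_cball \<Omega> ubar \<rho>. \<forall>uhat \<in> L2_cball \<Omega> ubar \<rho>.
    measure (lebesgue_on \<Omega>) {x \<in> \<Omega>. (F u x > 0) \<noteq> (F uhat x > 0)} \<le>
      measure lebesgue {x \<in> \<Omega>. F ubar x = 0} + \<eta>"
proof -
  let ?M = "lebesgue_on \<Omega>"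
  obtain R where R: "\<And>x. x \<in> \<Omega> \<Longrightarrow> norm x \<le> R" "0 < R"
    using \<Omega>(2) unfolding bounded_pos by blast
  define C where "C = 4 * R\<^sup>2"
  have C: "0 < C"
    using R(2) by (simp add: C_def)
  have lm: "\<Omega> \<in> lmeasurable"
    using \<Omega> by (intro lmeasurable_open)
  interpret finite_measure ?M
    by (rule finite_measure_lebesgue_on[OF lm])
  note F_sol = solution_operator_Lp_2(1)[OF F] and FL = solution_operator_Lp_2(2)[OF F]
  have F_meas: "F u \<in> borel_measurable ?M" if "u \<in> Lp 2 \<Omega>" for u
    using FL[OF that] by (simp add: Lp_2_iff)
  have "(\<lambda>n. measure ?M {x \<in> \<Omega>. \<bar>F ubar x\<bar> \<le> 1 / real (Suc n)}) \<longlonglongrightarrow>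
      measure ?M {x \<in> \<Omega>. F ubar x = 0}"
    by (rule measure_sublevel_tendsto_zero_set[OF lm F_meas[OF ub]])
  also have "measure ?M {x \<in> \<Omega>. F ubar x = 0} = measure lebesgue {x \<in> \<Omega>. F ubar x = 0}"
    using \<Omega>(1) by (intro measure_restrict_space) auto
  finally have "\<forall>\<^sub>F n in sequentially. measure ?M {x \<in> \<Omega>. \<bar>F ubar x\<bar> \<le> 1 / real (Suc n)} <
      measure lebesgue {x \<in> \<Omega>. F ubar x = 0} + \<eta> / 2"
    using \<eta> by (intro order_tendstoD(2)) auto
  then obtain n where n: "measure ?M {x \<in> \<Omega>. \<bar>F ubar x\<bar> \<le> 1 / real (Suc n)} <
      measure lebesgue {x \<in> \<Omega>. F ubar x = 0} + \<eta> / 2"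
    unfolding eventually_sequentially by blast
  define \<epsilon> where "\<epsilon> = 1 / real (Suc n)"
  have \<epsilon>: "0 < \<epsilon>"
    by (simp add: \<epsilon>_def)
  define E where "E = {x \<in> \<Omega>. \<bar>F ubar x\<bar> \<le> \<epsilon>}"
  define D where "D = (\<lambda>u. {x \<in> \<Omega>. \<epsilon> \<le> \<bar>F u x - F ubar x\<bar>})"
  \<comment> \<open>chosen so that Chebyshev's inequality bounds each deviation set by \<open>(C \<rho> / \<epsilon>)\<^sup>2 = \<eta> / 4\<close>\<close>
  define \<rho> where "\<rho> = \<epsilon> * sqrt (\<eta> / 4) / C"
  have \<rho>: "0 < \<rho>"
    using \<epsilon> \<eta> C by (simp add: \<rho>_def)
  have D_le: "measure ?M (D u) \<le> \<eta> / 4" and D_sets: "D u \<in> sets ?M"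
    if "u \<in> L2_cball \<Omega> ubar \<rho>" for u
  proof -
    have u: "u \<in> Lp 2 \<Omega>" "Lp_norm 2 \<Omega> (\<lambda>x. u x - ubar x) \<le> \<rho>"
      using that by (simp_all add: L2_cball_def)
    have "Lp_norm 2 \<Omega> (\<lambda>x. F u x - F ubar x) \<le> C * Lp_norm 2 \<Omega> (\<lambda>x. u x - ubar x)"
      unfolding C_def
      by (rule semilinear_solution_Lipschitz[OF \<Omega> R(1) less_imp_le[OF R(2)] F_sol[OF u(1)]
            F_sol[OF ub] u(1) ub])
    also have "\<dots> \<le> C * \<rho>"
      using u(2) C by (intro mult_left_mono) simp_all
    also have "\<dots> = \<epsilon> * sqrt (\<eta> / 4)"
      using C by (simp add: \<rho>_def)
    finally have "(Lp_norm 2 \<Omega> (\<lambda>x. F u x - F ubar x))\<^sup>2 \<le> (\<epsilon> * sqrt (\<eta> / 4))\<^sup>2"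
      by (intro power_mono Lp_norm_2_nonneg)
    also have "\<dots> = \<epsilon>\<^sup>2 * (\<eta> / 4)"
      using \<eta> by (simp add: power_mult_distrib)
    finally have "(Lp_norm 2 \<Omega> (\<lambda>x. F u x - F ubar x))\<^sup>2 / \<epsilon>\<^sup>2 \<le> \<eta> / 4"
      using \<epsilon> by (simp add: divide_le_eq mult.commute)
    then show "measure ?M (D u) \<le> \<eta> / 4"
      unfolding D_def
      using Chebyshev_Lp_2[OF Lp_2_diff[OF FL[OF u(1)] FL[OF ub]] \<epsilon>] by (rule order_trans[rotated])
    note [measurable] = F_meas[OF u(1)] F_meas[OF ub]
    have "{x \<in> space ?M. \<epsilon> \<le> \<bar>F u x - F ubar x\<bar>} \<in> sets ?M"
      by measurable
    then show "D u \<in> sets ?M"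
      by (simp add: D_def)
  qed
  have E: "E \<in> sets ?M"
  proof -
    note [measurable] = F_meas[OF ub]
    have "{x \<in> space ?M. \<bar>F ubar x\<bar> \<le> \<epsilon>} \<in> sets ?M"
      by measurable
    then show ?thesis
      by (simp add: E_def)
  qed
  show ?thesis
  proof (intro exI[of _ \<rho>] conjI ballI \<rho>)
    fix u uhat assume u: "u \<in> L2_cball \<Omega> ubar \<rho>" and uh: "uhat \<in> L2_cball \<Omega> ubar \<rho>"
    have "{x \<in> \<Omega>. (F u x > 0) \<noteq> (F uhat x > 0)} \<subseteq> E \<union> (D u \<union> D uhat)"
      unfolding E_def D_def by auto
    then have "measure ?M {x \<in> \<Omega>. (F u x > 0) \<noteq> (F uhat x > 0)} \<le>
        measure ?M (E \<union> (D u \<union> D uhat))"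
      using E D_sets[OF u] D_sets[OF uh] by (intro finite_measure_mono sets.Un)
    also have "\<dots> \<le> measure ?M E + measure ?M (D u \<union> D uhat)"
      using E D_sets[OF u] D_sets[OF uh] by (intro measure_Un_le sets.Un)
    also have "\<dots> \<le> measure ?M E + (measure ?M (D u) + measure ?M (D uhat))"
      using D_sets[OF u] D_sets[OF uh] by (intro add_left_mono measure_Un_le)
    also have "\<dots> \<le> measure lebesgue {x \<in> \<Omega>. F ubar x = 0} + \<eta>"
      using D_le[OF u] D_le[OF uh] n unfolding E_def \<epsilon>_def by linarith
    finally show "measure ?M {x \<in> \<Omega>. (F u x > 0) \<noteq> (F uhat x > 0)} \<le>
        measure lebesgue {x \<in> \<Omega>. F ubar x = 0} + \<eta>" .
  qed
qed

theorem proposition3p10: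
  fixes \<Omega> :: "'a::euclidean_space set"
    and F :: "('a \<Rightarrow> real) \<Rightarrow> ('a \<Rightarrow> real)"
    and G :: "('a \<Rightarrow> real) \<Rightarrow> ('a \<Rightarrow> real) \<Rightarrow> ('a \<Rightarrow> real)"
    and ubar :: "'a \<Rightarrow> real"
    and p p' L \<mu> :: real
  assumes "DIM('a) \<in> {2, 3}"
    and "bounded_lipschitz_domain \<Omega>"
    and "is_solution_operator \<Omega> F"
    and "is_linearized_operator \<Omega> F G"
    and "real DIM('a) / 2 < p" and "p < 2"
    and "p' = 2 * p / (2 - p)"
    and "L > 0"
    and "\<And>u h. u \<in> Lp 2 \<Omega> \<Longrightarrow> h \<in> Lp p \<Omega> \<Longrightarrow>
           continuous_on (closure \<Omega>) (G u h) \<and> sup_norm \<Omega> (G u h) \<le> L * Lp_norm p \<Omega> h"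
    and "ubar \<in> Lp 2 \<Omega>"
    and "\<mu> > 0"
    and "L * measure lebesgue \<Omega> powr (1 / 2)
           * (2 * measure lebesgue {x \<in> \<Omega>. F ubar x = 0}) powr (1 / p') < \<mu>"
  shows "\<exists>\<rho>>0. \<forall>u \<in> L2_cball \<Omega> ubar \<rho>. \<forall>uhat \<in> L2_cball \<Omega> ubar \<rho>.
           Lp_norm 2 \<Omega> (\<lambda>x. F uhat x - F u x - G u (\<lambda>z. uhat z - u z) x)
             \<le> \<mu> * Lp_norm 2 \<Omega> (\<lambda>x. F uhat x - F u x)"
proof -
  have \<Omega>: "open \<Omega>" "bounded \<Omega>"
    using assms(2) by (simp_all add: bounded_lipschitz_domain_def)
  have p0: "0 < p"
    using assms(5) by (rule le_less_trans[rotated]) simp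
  have p': "1 / p' = 1 / p - 1 / 2"
    unfolding assms(7) using p0 \<open>p < 2\<close> by (simp add: diff_divide_distrib)
  have p'0: "0 < 1 / p'"
    unfolding assms(7) using p0 \<open>p < 2\<close> by simp
  define K where "K = L * measure lebesgue \<Omega> powr (1 / 2)"
  have K: "0 \<le> K"
    using assms(8) by (simp add: K_def)
  \<comment> \<open>the strict inequality in the hypothesis leaves room to enlarge \<open>m\<close> slightly\<close>
  define m where "m = measure lebesgue {x \<in> \<Omega>. F ubar x = 0}"
  have m: "0 \<le> m"
    by (simp add: m_def)
  have "m powr (1 / p') \<le> (2 * m) powr (1 / p')"
    using p'0 m by (intro powr_mono2) simp_all
  then have "K * m powr (1 / p') \<le> K * (2 * m) powr (1 / p')"
    using K by (rule mult_left_mono)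
  also have "\<dots> < \<mu>"
    using assms(12) by (simp only: K_def m_def)
  finally have less: "K * m powr (1 / p') < \<mu>" .
  have "(\<lambda>n. m + inverse (real (Suc n))) \<longlonglongrightarrow> m + 0"
    by (intro tendsto_add tendsto_const LIMSEQ_inverse_real_of_nat)
  then have "(\<lambda>n. K * (m + inverse (real (Suc n))) powr (1 / p')) \<longlonglongrightarrow> K * m powr (1 / p')"
    using p'0 m by (intro tendsto_mult tendsto_const tendsto_powr') simp_all
  then have "\<forall>\<^sub>F n in sequentially. K * (m + inverse (real (Suc n))) powr (1 / p') < \<mu>"
    using less by (rule order_tendstoD(2))
  then obtain n where n: "K * (m + inverse (real (Suc n))) powr (1 / p') < \<mu>"
    unfolding eventually_sequentially by blast
  have "0 < inverse (real (Suc n))"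
    by simp
  from measure_sign_change_set_le[OF \<Omega> assms(3,10) this]
  obtain \<rho> where \<rho>: "0 < \<rho>" and small: "\<And>u uhat. u \<in> L2_cball \<Omega> ubar \<rho> \<Longrightarrow>
      uhat \<in> L2_cball \<Omega> ubar \<rho> \<Longrightarrow>
      measure (lebesgue_on \<Omega>) {x \<in> \<Omega>. (F u x > 0) \<noteq> (F uhat x > 0)} \<le> m + inverse (real (Suc n))"
    unfolding m_def[symmetric] by blast
  show ?thesis
  proof (intro exI[of _ \<rho>] conjI ballI \<rho>)
    fix u uhat assume ub: "u \<in> L2_cball \<Omega> ubar \<rho>" and uhb: "uhat \<in> L2_cball \<Omega> ubar \<rho>"
    then have u: "u \<in> Lp 2 \<Omega>" and uh: "uhat \<in> Lp 2 \<Omega>"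
      by (simp_all add: L2_cball_def)
    let ?S = "{x \<in> \<Omega>. (F u x > 0) \<noteq> (F uhat x > 0)}"
    have "Lp_norm 2 \<Omega> (\<lambda>x. F uhat x - F u x - G u (\<lambda>z. uhat z - u z) x) \<le>
        K * measure (lebesgue_on \<Omega>) ?S powr (1 / p') * Lp_norm 2 \<Omega> (\<lambda>x. F uhat x - F u x)"
      unfolding K_def p'
      by (rule linearization_error_le[OF \<Omega> assms(3,4,5,6) less_imp_le[OF assms(8)] assms(9)[OF u] u uh])
    also have "\<dots> \<le> \<mu> * Lp_norm 2 \<Omega> (\<lambda>x. F uhat x - F u x)"
    proof (rule mult_right_mono[OF _ Lp_norm_2_nonneg])
      have "K * measure (lebesgue_on \<Omega>) ?S powr (1 / p') \<le> K * (m + inverse (real (Suc n))) powr (1 / p')"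
        using p'0 small[OF ub uhb] by (intro mult_left_mono[OF _ K] powr_mono2) simp_all
      then show "K * measure (lebesgue_on \<Omega>) ?S powr (1 / p') \<le> \<mu>"
        using n by simp
    qed
    finally show "Lp_norm 2 \<Omega> (\<lambda>x. F uhat x - F u x - G u (\<lambda>z. uhat z - u z) x)
             \<le> \<mu> * Lp_norm 2 \<Omega> (\<lambda>x. F uhat x - F u x)" .
  qed
qed

end
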